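(* There exist constants $c>0$ and $c_1>0$, depending only on $d$ and $a$ (in particular independent of $k$, $m$, $L$ and $\bar\mu_0$), such that for every $f\in\mathcal L^\infty(\Omega)$ and every $x\in\Omega$, $$|(G_k(\Omega)f)(x)|\le c\,L^{2d}\,e^{-c_1\,\mathrm{dist}(x,\mathrm{supp} f)}\,\|f\|_\infty .$$
   Context: Standing setup. Fix an integer $d\ge1$, an odd integer $L>1$, integers $k\ge1$, $m\ge k$, and set $\eta=L^{-k}$. Let $\Omega=\eta\{0,1,\dots,L^m-1\}^d\subset\eta\mathbb Z^d$ and, for $0\le j\le m$, $\Omega_j=(L^j\eta)\{0,1,\dots,L^{m-j}-1\}^d$ (so $\Omega_k\subset\mathbb Z^d$ has unit spacing). For a finite set $O$ contained in a lattice of spacing $\epsilon$, $\mathcal L^2(O)$ denotes complex functions on $O$ with $\langle f,g\rangle=\epsilon^d\sum_{x\in O}\overline{f(x)}g(x)$, and $\|f\|_\infty=\max_{x}|f(x)|$. For $y\in (L^j\eta)\mathbb Z^d$ let $B_j(y)=\{x\in\eta\mathbb Z^d:\ y_\mu\le x_\mu<y_\mu+L^j\eta,\ \mu=0,\dots,d-1\}$; $\Omega$ is the disjoint union of the $B_j(y)$, $y\in\Omega_j$. The averaging operator $Q_{\Omega,j}:\mathcal L^2(\Omega)\to\mathcal L^2(\Omega_j)$ is $(Q_{\Omega,j}f)(y)=L^{-jd}\sum_{x\in B_j(y)}f(x)$; its adjoint is $(Q_{\Omega,j}^*h)(x)=h(y_x)$ where $y_x\in\Omega_j$ is the unique label with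 $x\in B_j(y_x)$. The Neumann Laplacian on $\Omega$ is $(\Delta^\eta_\Omega f)(x)=\eta^{-2}\sum_{\mu=0}^{d-1}\big(f(x+\eta e_\mu)-2f(x)+f(x-\eta e_\mu)\big)$, where any value $f(x\pm\eta e_\mu)$ with $x\pm\eta e_\mu\notin\Omega$ is replaced by $f(x)$ ($e_\mu$ the unit vectors). Fix $a\in(0,1]$ and set $a_j=a\frac{1-L^{-2}}{1-L^{-2j}}$ for $j\ge1$. Fix $\bar\mu_0\ge0$ and set $\bar\mu_j=L^{2j}\bar\mu_0$. Define $G_k(\Omega)=\big(-\Delta^\eta_\Omega+\bar\mu_k+a_kQ_{\Omega,k}^*Q_{\Omega,k}\big)^{-1}$ on $\mathcal L^2(\Omega)$. $|x-y|$ is the Euclidean distance and $\mathrm{dist}(x,S)=\min_{y\in S}|x-y|$. *)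

theory Defs
  imports "HOL-Analysis.Analysis"
begin

text \<open>Lattice points are encoded by integer coordinates: a point x of \<Omega> with spacing
 eta = L^-k is eta * n, n : nat \<Rightarrow> nat, with n mu < L^m for mu < d and n mu = 0 for mu \<ge> d.\<close>

definition Omega :: "nat \<Rightarrow> nat \<Rightarrow> nat \<Rightarrow> (nat \<Rightarrow> nat) set" where
  "Omega d L m = {n. (\<forall>\<mu><d. n \<mu> < L ^ m) \<and> (\<forall>\<mu>. d \<le> \<mu> \<longrightarrow> n \<mu> = 0)}"

definition eta :: "nat \<Rightarrow> nat \<Rightarrow> real" where
  "eta L k = 1 / real L ^ k"

definition pdist :: "nat \<Rightarrow> nat \<Rightarrow> nat \<Rightarrow> (nat \<Rightarrow> nat) \<Rightarrow> (nat \<Rightarrow> nat) \<Rightarrow> real" where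
  "pdist d L k n n' = eta L k * sqrt (\<Sum>\<mu><d. (real (n \<mu>) - real (n' \<mu>))^2)"

definition supp_on :: "(nat \<Rightarrow> nat) set \<Rightarrow> ((nat \<Rightarrow> nat) \<Rightarrow> complex) \<Rightarrow> (nat \<Rightarrow> nat) set" where
  "supp_on S f = {x \<in> S. f x \<noteq> 0}"

definition dist_set :: "nat \<Rightarrow> nat \<Rightarrow> nat \<Rightarrow> (nat \<Rightarrow> nat) \<Rightarrow> (nat \<Rightarrow> nat) set \<Rightarrow> real" where
  "dist_set d L k x S = Min ((\<lambda>y. pdist d L k x y) ` S)"

definition supnorm :: "(nat \<Rightarrow> nat) set \<Rightarrow> ((nat \<Rightarrow> nat) \<Rightarrow> complex) \<Rightarrow> real" where
  "supnorm S f = Max ((\<lambda>x. cmod (f x)) ` S)"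

text \<open>Neumann Laplacian on \<Omega>: neighbours outside \<Omega> are replaced by the value at x.\<close>
definition nbr_plus :: "nat \<Rightarrow> nat \<Rightarrow> ((nat \<Rightarrow> nat) \<Rightarrow> complex) \<Rightarrow> (nat \<Rightarrow> nat) \<Rightarrow> nat \<Rightarrow> complex" where
  "nbr_plus L m f x \<mu> = (if x \<mu> + 1 < L ^ m then f (x(\<mu> := x \<mu> + 1)) else f x)"

definition nbr_minus :: "((nat \<Rightarrow> nat) \<Rightarrow> complex) \<Rightarrow> (nat \<Rightarrow> nat) \<Rightarrow> nat \<Rightarrow> complex" where
  "nbr_minus f x \<mu> = (if 0 < x \<mu> then f (x(\<mu> := x \<mu> - 1)) else f x)"

definition Laplacian :: "nat \<Rightarrow> nat \<Rightarrow> nat \<Rightarrow> nat \<Rightarrow> ((nat \<Rightarrow> nat) \<Rightarrow> complex) \<Rightarrow> (nat \<Rightarrow> nat) \<Rightarrow> complex" where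
  "Laplacian d L k m f x = inverse (complex_of_real (eta L k ^ 2)) *
     (\<Sum>\<mu><d. nbr_plus L m f x \<mu> - 2 * f x + nbr_minus f x \<mu>)"

text \<open>Averaging operator Q_{\<Omega>,j}: block labels y in \<Omega>_j are encoded by integer
 coordinates y (physical point L^j eta y); x \<in> B_j(y) iff x mu div L^j = y mu for mu < d.\<close>
definition Qop :: "nat \<Rightarrow> nat \<Rightarrow> nat \<Rightarrow> nat \<Rightarrow> ((nat \<Rightarrow> nat) \<Rightarrow> complex) \<Rightarrow> (nat \<Rightarrow> nat) \<Rightarrow> complex" where
  "Qop d L m j f y = inverse (complex_of_real (real L ^ (j * d))) *
     (\<Sum>x\<in>{x \<in> Omega d L m. \<forall>\<mu><d. x \<mu> div L ^ j = y \<mu>}. f x)"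

definition Qadj :: "nat \<Rightarrow> nat \<Rightarrow> nat \<Rightarrow> ((nat \<Rightarrow> nat) \<Rightarrow> complex) \<Rightarrow> (nat \<Rightarrow> nat) \<Rightarrow> complex" where
  "Qadj d L j h x = h (\<lambda>\<mu>. if \<mu> < d then x \<mu> div L ^ j else 0)"

definition a_seq :: "real \<Rightarrow> nat \<Rightarrow> nat \<Rightarrow> real" where
  "a_seq a L j = a * (1 - real L powr (-2)) / (1 - real L powr (- 2 * real j))"

definition mu_seq :: "real \<Rightarrow> nat \<Rightarrow> nat \<Rightarrow> real" where
  "mu_seq mu0 L j = real L ^ (2 * j) * mu0"

definition Aop :: "nat \<Rightarrow> nat \<Rightarrow> nat \<Rightarrow> nat \<Rightarrow> real \<Rightarrow> real \<Rightarrow>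
    ((nat \<Rightarrow> nat) \<Rightarrow> complex) \<Rightarrow> (nat \<Rightarrow> nat) \<Rightarrow> complex" where
  "Aop d L k m a mu0 g x = - Laplacian d L k m g x
     + complex_of_real (mu_seq mu0 L k) * g x
     + complex_of_real (a_seq a L k) * Qadj d L k (Qop d L m k g) x"

text \<open>G_k(\<Omega>) = Aop^{-1}: functions on \<Omega> are represented by functions vanishing off \<Omega>.\<close>
definition Gk :: "nat \<Rightarrow> nat \<Rightarrow> nat \<Rightarrow> nat \<Rightarrow> real \<Rightarrow> real \<Rightarrow>
    ((nat \<Rightarrow> nat) \<Rightarrow> complex) \<Rightarrow> (nat \<Rightarrow> nat) \<Rightarrow> complex" where
  "Gk d L k m a mu0 f = (THE g. (\<forall>x. x \<notin> Omega d L m \<longrightarrow> g x = 0) \<and>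
      (\<forall>x\<in>Omega d L m. Aop d L k m a mu0 g x = f x))"

end

theory Submission
  imports Defs "HOL-Library.Function_Algebras"
begin

text \<open>Let \<open>A\<close> be the operator to be inverted and \<open>A g = f\<close>. A lattice Poincare inequality on
 the unit cells gives coercivity of \<open>A\<close> in \<open>L\<^sup>2\<close>, which survives conjugation with the weight
 \<open>exp (- \<delta> |x - x0|)\<close> for small \<open>\<delta>\<close>; this bounds \<open>g\<close> in \<open>L\<^sup>2\<close> near \<open>x0\<close> with exponential
 decay. To pass to the value \<open>g x0\<close>, write \<open>R\<close> for the inverse of \<open>T = 1 + m - \<Delta>\<close>, so that
 \<open>g = \<Sum>\<^sub>j\<^sub><\<^sub>n R\<^sup>j\<^sup>+\<^sup>1 h + R\<^sup>n g\<close> with \<open>h = f - b Q\<^sup>* Q g\<close>. The kernels of \<open>R\<^sup>j\<close> are nonnegative and are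
 integrated against a product of hyperbolic cosines, a supersolution of \<open>T\<close>; for \<open>n = 2d\<close> they are bounded,
 because \<open>\<Prod>\<^sub>\<nu> (1 - \<Delta>\<^sub>\<nu>)\<close> controls the sup norm by the one-dimensional Sobolev inequality in each
 direction while every \<open>(1 - \<Delta>\<^sub>\<nu>) R\<close> is an \<open>L\<^sup>2\<close> contraction.\<close>

section \<open>Finite linear algebra\<close>

text \<open>No single tool gives both decay and a pointwise bound. The block average couples
  distinct sites with the sign that breaks the maximum principle, so the full operator is treated by
  quadratic forms only; but a plain L2 sum bounds the square of a single value only up to a loss of
  \<open>N ^ d\<close>, which is not uniform in \<open>k\<close>. Dropping the average restores
  positivity of the inverse, and mass 1 keeps this inverse bounded even when \<open>mu0 = 0\<close>.
  Smoothing \<open>2 * d\<close> times gives the kernel bound \<open>(2 / N) ^ d\<close>, which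
  cancels the volume factor \<open>N ^ d\<close> of the L2 estimate; hence constants uniform in
  \<open>L\<close>, \<open>k\<close> and \<open>m\<close>. The final rate is half of \<delta>: of
  the squared weight \<open>exp (- 2 * \<delta> * rdist)\<close>, one half is kept as decay and the
  other makes the lattice sum converge. Distances are measured in the l1 norm, in which exponentials
  factor over coordinates and which dominates the Euclidean distance.\<close>

text \<open>A dimension count: injectivity carries the indicators of the points of \<open>S\<close>
  to equally many independent vectors in the same span, which therefore generate it.\<close>

lemma injective_imp_surjective_finite_support:
  fixes T :: "('a \<Rightarrow> real) \<Rightarrow> 'a \<Rightarrow> real"
  assumes fin: "finite S"
    and lin: "\<And>f g c x. T (\<lambda>y. c * f y + g y) x = c * T f x + T g x"
    and inj: "\<And>g. \<lbrakk>\<And>x. x \<notin> S \<Longrightarrow> g x = 0; \<And>x. x \<in> S \<Longrightarrow> T g x = 0\<rbrakk> \<Longrightarrow> g = (\<lambda>x. 0)"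
  shows "\<exists>g. (\<forall>x. x \<notin> S \<longrightarrow> g x = 0) \<and> (\<forall>x\<in>S. T g x = f x)"
proof -
  let ?sc = "\<lambda>(c::real) (f::'a \<Rightarrow> real) x. c * f x"
  interpret V: vector_space ?sc
    by unfold_locales (auto simp: fun_eq_iff algebra_simps)
  interpret VP: vector_space_pair ?sc ?sc ..
  \<comment> \<open>Cutting the output off outside \<open>S\<close> makes the map an endomorphism of
    the span of the indicators.\<close>
  define U where "U g x = (if x \<in> S then T g x else 0)" for g x
  define e :: "'a \<Rightarrow> 'a \<Rightarrow> real" where "e a = (\<lambda>x. if x = a then 1 else 0)" for a
  have T_add: "T (\<lambda>y. p y + q y) x = T p x + T q x" for p q x
    using lin[of 1 p q x] by simp
  have T_zero: "T (\<lambda>y. 0) x = 0" for x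
    using T_add[of "\<lambda>y. 0" "\<lambda>y. 0" x] by simp
  have T_scale: "T (\<lambda>y. c * p y) x = c * T p x" for c p x
    using lin[of c p "\<lambda>y. 0" x] T_zero by simp
  have linU: "Vector_Spaces.linear ?sc ?sc U"
    by unfold_locales
      (auto simp: U_def fun_eq_iff plus_fun_def T_add T_scale distrib_left)
  have span_e: "(\<forall>x. x \<notin> S \<longrightarrow> g x = 0) \<longleftrightarrow> g \<in> V.span (e ` S)" for g
  proof
    assume g: "\<forall>x. x \<notin> S \<longrightarrow> g x = 0"
    have "g = (\<Sum>a\<in>S. ?sc (g a) (e a))"
    proof
      fix x
      have "(\<Sum>a\<in>S. ?sc (g a) (e a)) x = (\<Sum>a\<in>S. g a * e a x)"
        by (induction S rule: infinite_finite_induct) auto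
      also have "\<dots> = (\<Sum>a\<in>S. if a = x then g x else 0)"
        by (intro sum.cong) (auto simp: e_def)
      also have "\<dots> = g x" using g fin by simp
      finally show "g x = (\<Sum>a\<in>S. ?sc (g a) (e a)) x" by simp
    qed
    moreover have "(\<Sum>a\<in>S. ?sc (g a) (e a)) \<in> V.span (e ` S)"
      by (intro V.span_sum V.span_scale V.span_base) auto
    ultimately show "g \<in> V.span (e ` S)" by simp
  next
    assume "g \<in> V.span (e ` S)"
    then show "\<forall>x. x \<notin> S \<longrightarrow> g x = 0"
    proof (induction rule: V.span_induct_alt)
      case base show ?case by simp
    next
      case (step c x y) then show ?case by (auto simp: e_def split: if_splits)
    qed
  qed
  have inj_span: "inj_on U (V.span (e ` S))"
  proof (rule inj_onI)
    fix p q assume p: "p \<in> V.span (e ` S)" and q: "q \<in> V.span (e ` S)" and eq: "U p = U q"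
    have "(\<lambda>y. (-1) * q y + p y) = (\<lambda>x. 0)"
    proof (rule inj)
      fix x assume "x \<notin> S" then show "(-1) * q x + p x = 0"
        using p q span_e[of p] span_e[of q] by simp
    next
      fix x assume "x \<in> S" then show "T (\<lambda>y. (-1) * q y + p y) x = 0"
        using fun_cong[OF eq, of x] lin[of "-1" q p x] by (simp add: U_def)
    qed
    then show "p = q" by (auto simp: fun_eq_iff dest: fun_cong)
  qed
  have indep: "V.independent (e ` S)"
    unfolding V.dependent_finite[OF finite_imageI[OF fin]]
  proof (clarsimp)
    fix u a assume a: "a \<in> S" "u (e a) \<noteq> 0" and z: "(\<Sum>v\<in>e ` S. ?sc (u v) v) = 0"
    have "inj_on e S" by (rule inj_onI) (metis e_def zero_neq_one)
    then have "(\<Sum>v\<in>e ` S. ?sc (u v) v) = (\<Sum>b\<in>S. ?sc (u (e b)) (e b))"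
      by (simp add: sum.reindex o_def)
    then have "0 = (\<Sum>b\<in>S. ?sc (u (e b)) (e b)) a" using z by simp
    also have "\<dots> = (\<Sum>b\<in>S. u (e b) * e b a)"
      by (induction S rule: infinite_finite_induct) auto
    also have "\<dots> = (\<Sum>b\<in>S. if b = a then u (e a) else 0)"
      by (intro sum.cong) (auto simp: e_def)
    also have "\<dots> = u (e a)" using a fin by simp
    finally show False using a by simp
  qed
  let ?I = "U ` e ` S"
  have indI: "V.independent ?I"
    using VP.linear_independent_injective_image[OF linU indep inj_span] .
  have sub: "?I \<subseteq> V.span (e ` S)"
    by (auto simp: U_def simp flip: span_e)
  have card: "card ?I = card (e ` S)"
    by (intro card_image inj_on_subset[OF inj_span] V.span_superset)
  \<comment> \<open>A vector outside the span of the images would enlarge them to an independent set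
    with more elements than there are indicators.\<close>
  have "V.span (e ` S) \<subseteq> V.span ?I"
  proof (rule ccontr)
    assume "\<not> V.span (e ` S) \<subseteq> V.span ?I"
    then obtain v where v: "v \<in> V.span (e ` S)" "v \<notin> V.span ?I" by blast
    then have "V.independent (insert v ?I)"
      using indI by (simp add: V.independent_insert)
    then have "card (insert v ?I) \<le> card (e ` S)"
      using V.independent_span_bound[OF finite_imageI[OF fin]] v(1) sub by (meson insert_subset)
    moreover have "v \<notin> ?I" using v(2) V.span_base by metis
    ultimately show False using fin card by (metis not_less_eq_eq order_refl card_insert_disjoint finite_imageI)
  qed
  then have "V.span (e ` S) \<subseteq> U ` V.span (e ` S)"
    using VP.linear_span_image[OF linU, of "e ` S"] by simp
  moreover have "(\<lambda>x. if x \<in> S then f x else 0) \<in> V.span (e ` S)"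
    by (simp flip: span_e)
  ultimately obtain g where "g \<in> V.span (e ` S)" "(\<lambda>x. if x \<in> S then f x else 0) = U g"
    by blast
  then show ?thesis
    unfolding span_e[symmetric] U_def fun_eq_iff by metis
qed

section \<open>Sums over lattice boxes\<close>

text \<open>The coordinate sets may vary with the direction so that the whole cube and a single
  averaging block are both instances.\<close>

definition gbox :: "nat \<Rightarrow> (nat \<Rightarrow> nat set) \<Rightarrow> (nat \<Rightarrow> nat) set" where
  "gbox d S = {x. (\<forall>\<mu><d. x \<mu> \<in> S \<mu>) \<and> (\<forall>\<mu>. d \<le> \<mu> \<longrightarrow> x \<mu> = 0)}"

lemma gbox_0: "gbox 0 S = {\<lambda>_. 0}"
  by (auto simp: gbox_def)

lemma gbox_Suc: "gbox (Suc d) S = (\<lambda>(x, t). x(d := t)) ` (gbox d S \<times> S d)"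
proof (intro equalityI subsetI)
  fix x assume x: "x \<in> gbox (Suc d) S"
  have "x = (\<lambda>(x, t). x(d := t)) (x(d := 0), x d)" by simp
  moreover have "(x(d := 0), x d) \<in> gbox d S \<times> S d"
    using x by (auto simp: gbox_def)
  ultimately show "x \<in> (\<lambda>(x, t). x(d := t)) ` (gbox d S \<times> S d)" by (rule image_eqI)
qed (auto simp: gbox_def less_Suc_eq)

lemma inj_on_gbox_Suc: "inj_on (\<lambda>(x, t). x(d := t)) (gbox d S \<times> S d)"
proof (rule inj_onI, clarify)
  fix x t y s
  assume xy: "x \<in> gbox d S" "y \<in> gbox d S" and eq: "x(d := t) = y(d := s)"
  have "x \<mu> = y \<mu>" for \<mu>
    using fun_cong[OF eq, of \<mu>] xy by (cases "\<mu> = d") (auto simp: gbox_def)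
  then show "x = y \<and> t = s" using fun_cong[OF eq, of d] by auto
qed

lemma finite_gbox: "(\<And>\<mu>. \<mu> < d \<Longrightarrow> finite (S \<mu>)) \<Longrightarrow> finite (gbox d S)"
  by (induction d) (auto simp: gbox_0 gbox_Suc)

text \<open>Fubini for products over coordinates. It reduces exponential sums over the cube to one
  dimension, and with all factors 1 it counts points.\<close>

lemma sum_prod_gbox:
  fixes f :: "nat \<Rightarrow> nat \<Rightarrow> real"
  shows "(\<Sum>x\<in>gbox d S. \<Prod>\<mu><d. f \<mu> (x \<mu>)) = (\<Prod>\<mu><d. \<Sum>t\<in>S \<mu>. f \<mu> t)"
proof (induction d)
  case 0 show ?case by (simp add: gbox_0)
next
  case (Suc d)
  have "(\<Sum>x\<in>gbox (Suc d) S. \<Prod>\<mu><Suc d. f \<mu> (x \<mu>))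
      = (\<Sum>p\<in>gbox d S \<times> S d. \<Prod>\<mu><Suc d. f \<mu> (((fst p)(d := snd p)) \<mu>))"
    unfolding gbox_Suc by (subst sum.reindex[OF inj_on_gbox_Suc]) (simp add: case_prod_unfold)
  also have "\<dots> = (\<Sum>p\<in>gbox d S \<times> S d. (\<Prod>\<mu><d. f \<mu> (fst p \<mu>)) * f d (snd p))"
    by (intro sum.cong) auto
  also have "\<dots> = (\<Sum>x\<in>gbox d S. \<Prod>\<mu><d. f \<mu> (x \<mu>)) * (\<Sum>t\<in>S d. f d t)"
    by (simp add: sum_product sum.cartesian_product case_prod_unfold)
  finally show ?case using Suc.IH by simp
qed

lemma card_gbox: "card (gbox d S) = (\<Prod>\<mu><d. card (S \<mu>))"
proof -
  have "real (card (gbox d S)) = (\<Sum>x\<in>gbox d S. \<Prod>\<mu><d. (\<lambda>_ _. 1) \<mu> (x \<mu>))" by simp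
  also have "\<dots> = (\<Prod>\<mu><d. \<Sum>t\<in>S \<mu>. 1)" by (subst sum_prod_gbox) simp
  finally show ?thesis by (simp flip: of_nat_prod)
qed

definition cube :: "nat \<Rightarrow> nat \<Rightarrow> (nat \<Rightarrow> nat) set" where
  "cube d M = gbox d (\<lambda>_. {..<M})"

lemma Omega_eq_cube: "Omega d L m = cube d (L ^ m)"
  by (auto simp: Omega_def cube_def gbox_def)

lemma finite_cube [simp]: "finite (cube d M)"
  by (simp add: cube_def finite_gbox)

lemma cube_less: "x \<in> cube d M \<Longrightarrow> \<mu> < d \<Longrightarrow> x \<mu> < M"
  by (auto simp: cube_def gbox_def)

lemma cube_upd: "x \<in> cube d M \<Longrightarrow> \<mu> < d \<Longrightarrow> t < M \<Longrightarrow> x(\<mu> := t) \<in> cube d M"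
  by (auto simp: cube_def gbox_def)

section \<open>The one-directional Neumann Laplacian\<close>

text \<open>Lattice units: \<open>nlap M \<mu>\<close> is minus the unscaled second difference in direction \<open>\<mu>\<close>; the factor
 \<open>\<eta>\<^sup>-\<^sup>2 = N\<^sup>2\<close>, with \<open>N = L ^ k\<close> and side length \<open>M = L ^ m\<close>, is carried separately, and all
 norms below are plain sums without the factor \<open>\<eta>\<^sup>d\<close>.\<close>

definition nlap :: "nat \<Rightarrow> nat \<Rightarrow> ((nat \<Rightarrow> nat) \<Rightarrow> real) \<Rightarrow> (nat \<Rightarrow> nat) \<Rightarrow> real" where
  "nlap M \<mu> f x = (if Suc (x \<mu>) < M then f x - f (x(\<mu> := Suc (x \<mu>))) else 0)
     + (if 0 < x \<mu> then f x - f (x(\<mu> := x \<mu> - 1)) else 0)"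

definition fdiff :: "nat \<Rightarrow> ((nat \<Rightarrow> nat) \<Rightarrow> real) \<Rightarrow> (nat \<Rightarrow> nat) \<Rightarrow> real" where
  "fdiff \<mu> f x = f (x(\<mu> := Suc (x \<mu>))) - f x"

text \<open>Isolates what summation by parts in one direction requires. Besides the cube it covers a
  single lattice line (Sobolev) and the edge set of another direction (mixed second
  differences).\<close>

definition line_closed :: "nat \<Rightarrow> nat \<Rightarrow> (nat \<Rightarrow> nat) set \<Rightarrow> bool" where
  "line_closed M \<mu> S \<longleftrightarrow> finite S \<and> (\<forall>x\<in>S. x \<mu> < M \<and> (\<forall>t<M. x(\<mu> := t) \<in> S))"

definition edges :: "nat \<Rightarrow> nat \<Rightarrow> (nat \<Rightarrow> nat) set \<Rightarrow> (nat \<Rightarrow> nat) set" where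
  "edges M \<mu> S = {x \<in> S. Suc (x \<mu>) < M}"

lemma finite_edges [simp]: "finite S \<Longrightarrow> finite (edges M \<mu> S)"
  by (simp add: edges_def)

lemma line_closed_cube: "\<mu> < d \<Longrightarrow> line_closed M \<mu> (cube d M)"
  by (simp add: line_closed_def cube_less cube_upd)

lemma line_closed_edges:
  "\<lbrakk>line_closed M \<nu> S; \<mu> \<noteq> \<nu>\<rbrakk> \<Longrightarrow> line_closed M \<nu> (edges M \<mu> S)"
  by (auto simp: line_closed_def edges_def)

lemma line_closed_line: "x \<mu> < M \<Longrightarrow> line_closed M \<mu> ((\<lambda>t. x(\<mu> := t)) ` {..<M})"
  by (auto simp: line_closed_def)

lemma sum_shift_edges:
  assumes "line_closed M \<mu> S"
  shows "(\<Sum>x\<in>{x \<in> S. 0 < x \<mu>}. f x) = (\<Sum>x\<in>edges M \<mu> S. f (x(\<mu> := Suc (x \<mu>))))"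
  using assms
  by (intro sum.reindex_bij_witness[of _ "\<lambda>x. x(\<mu> := Suc (x \<mu>))" "\<lambda>x. x(\<mu> := x \<mu> - 1)"])
    (auto simp: line_closed_def edges_def)

text \<open>Each edge receives one term from each of its endpoints. The Neumann condition leaves no
  boundary terms, since a missing neighbour contributes 0.\<close>

lemma sum_nlap_by_parts:
  assumes "line_closed M \<mu> S"
  shows "(\<Sum>x\<in>S. f x * nlap M \<mu> g x) = (\<Sum>x\<in>edges M \<mu> S. fdiff \<mu> f x * fdiff \<mu> g x)"
proof -
  have fin: "finite S" using assms by (simp add: line_closed_def)
  have "(\<Sum>x\<in>S. f x * nlap M \<mu> g x)
      = (\<Sum>x\<in>S. if Suc (x \<mu>) < M then f x * (g x - g (x(\<mu> := Suc (x \<mu>)))) else 0)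
      + (\<Sum>x\<in>S. if 0 < x \<mu> then f x * (g x - g (x(\<mu> := x \<mu> - 1))) else 0)"
    by (simp add: nlap_def distrib_left if_distrib[of "(*) _"] sum.distrib cong: if_cong)
  also have "\<dots> = (\<Sum>x\<in>edges M \<mu> S. f x * (g x - g (x(\<mu> := Suc (x \<mu>)))))
      + (\<Sum>x\<in>{x \<in> S. 0 < x \<mu>}. f x * (g x - g (x(\<mu> := x \<mu> - 1))))"
    by (simp only: sum.inter_filter[OF fin] edges_def)
  also have "\<dots> = (\<Sum>x\<in>edges M \<mu> S. fdiff \<mu> f x * fdiff \<mu> g x)"
    unfolding sum_shift_edges[OF assms] by (simp add: fdiff_def algebra_simps flip: sum.distrib)
  finally show ?thesis .
qed

lemma sum_nlap_selfadjoint: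
  "line_closed M \<mu> S \<Longrightarrow> (\<Sum>x\<in>S. f x * nlap M \<mu> g x) = (\<Sum>x\<in>S. nlap M \<mu> f x * g x)"
  using sum_nlap_by_parts[of M \<mu> S f g] sum_nlap_by_parts[of M \<mu> S g f]
  by (simp add: mult.commute)

lemma sum_nlap_nonneg: "line_closed M \<mu> S \<Longrightarrow> 0 \<le> (\<Sum>x\<in>S. f x * nlap M \<mu> f x)"
  by (simp add: sum_nlap_by_parts sum_nonneg)

lemma nlap_lincomb: "nlap M \<mu> (\<lambda>y. c * f y + g y) x = c * nlap M \<mu> f x + nlap M \<mu> g x"
  by (simp add: nlap_def algebra_simps)

lemma nlap_cong:
  "\<lbrakk>line_closed M \<mu> S; x \<in> S; \<And>y. y \<in> S \<Longrightarrow> f y = g y\<rbrakk> \<Longrightarrow> nlap M \<mu> f x = nlap M \<mu> g x"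
  by (auto simp: nlap_def line_closed_def)

lemma nlap_commute: "\<mu> \<noteq> \<nu> \<Longrightarrow> nlap M \<mu> (nlap M \<nu> f) x = nlap M \<nu> (nlap M \<mu> f) x"
  by (simp add: nlap_def fun_upd_twist)

lemma fdiff_nlap: "\<mu> \<noteq> \<nu> \<Longrightarrow> fdiff \<mu> (nlap M \<nu> f) x = nlap M \<nu> (fdiff \<mu> f) x"
  by (simp add: nlap_def fdiff_def fun_upd_twist)

text \<open>For distinct directions the operators commute: summing by parts along \<mu> leaves the
  form of \<open>nlap M \<nu>\<close> at \<open>fdiff \<mu> f\<close> on the \<mu>-edges, a set
  still closed along \<nu>.\<close>

lemma sum_nlap_nlap_nonneg:
  assumes "line_closed M \<mu> S" "line_closed M \<nu> S"
  shows "0 \<le> (\<Sum>x\<in>S. nlap M \<mu> f x * nlap M \<nu> f x)"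
proof (cases "\<mu> = \<nu>")
  case True then show ?thesis by (simp add: sum_nonneg)
next
  case False
  have "(\<Sum>x\<in>S. nlap M \<mu> f x * nlap M \<nu> f x) = (\<Sum>x\<in>S. f x * nlap M \<mu> (nlap M \<nu> f) x)"
    by (simp add: sum_nlap_selfadjoint[OF assms(1)])
  also have "\<dots> = (\<Sum>x\<in>edges M \<mu> S. fdiff \<mu> f x * nlap M \<nu> (fdiff \<mu> f) x)"
    unfolding sum_nlap_by_parts[OF assms(1)] fdiff_nlap[OF False] ..
  also have "\<dots> \<ge> 0"
    by (rule sum_nlap_nonneg) (rule line_closed_edges[OF assms(2) False])
  finally show ?thesis .
qed

section \<open>Sobolev and Poincare inequalities on blocks\<close>

text \<open>Divisibility ensures that the boundary of the cube cuts no block.\<close>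

lemma block_less: "\<lbrakk>0 < N; N dvd M; s < M; t div N = s div N\<rbrakk> \<Longrightarrow> t < (M::nat)"
proof -
  assume a: "0 < N" "N dvd M" "s < M" "t div N = s div N"
  obtain q where q: "M = N * q" using a by blast
  have "s div N < q" using a q by (simp add: less_mult_imp_div_less mult.commute)
  then show ?thesis using q a by (metis mult.commute div_less_iff_less_mult)
qed

text \<open>Telescoping over at most \<open>N\<close> edges and Cauchy-Schwarz. Edges are labelled
  by their lower endpoint, so the edge leaving the block is included and every edge belongs to
  exactly one block.\<close>

lemma square_diff_le_block:
  fixes p :: "nat \<Rightarrow> real" and N M s t :: nat
  assumes "0 < N" "N dvd M" "s < M" "s div N = t div N"
  shows "(p s - p t)\<^sup>2 \<le> N * (\<Sum>r | r div N = s div N \<and> Suc r < M. (p (Suc r) - p r)\<^sup>2)"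
proof -
  have key: "(p u - p v)\<^sup>2 \<le> N * (\<Sum>r | r div N = s div N \<and> Suc r < M. (p (Suc r) - p r)\<^sup>2)"
    if uv: "v \<le> u" "u div N = s div N" "v div N = s div N" "u < M" for u v
  proof -
    have R: "finite {r. r div N = s div N \<and> Suc r < M}"
      by (rule finite_subset[of _ "{..<M}"]) auto
    have sub: "{v..<u} \<subseteq> {r. r div N = s div N \<and> Suc r < M}"
    proof clarsimp
      fix r assume r: "v \<le> r" "r < u"
      then have "v div N \<le> r div N" "r div N \<le> u div N" by (auto intro: div_le_mono)
      then show "r div N = s div N \<and> Suc r < M" using uv r by simp
    qed
    have "u - v \<le> N"
    proof -
      have "u = s div N * N + u mod N" "v = s div N * N + v mod N"
        using uv div_mult_mod_eq[of u N] div_mult_mod_eq[of v N] by simp_all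
      moreover have "u mod N < N" using assms by simp
      ultimately show ?thesis by linarith
    qed
    have "(p u - p v)\<^sup>2 = (\<Sum>r\<in>{v..<u}. p (Suc r) - p r)\<^sup>2"
      using uv by (simp add: sum_Suc_diff')
    also have "\<dots> \<le> (\<Sum>r\<in>{v..<u}. (p (Suc r) - p r)\<^sup>2) * card {v..<u}"
      by (rule sum_squared_le_sum_of_squares)
    also have "\<dots> \<le> (\<Sum>r | r div N = s div N \<and> Suc r < M. (p (Suc r) - p r)\<^sup>2) * N"
      using \<open>u - v \<le> N\<close> by (intro mult_mono sum_mono2[OF R sub] sum_nonneg) auto
    finally show ?thesis by (simp add: mult.commute)
  qed
  have "t < M" using block_less[OF assms(1-3) assms(4)[symmetric]] .
  show ?thesis
  proof (cases "t \<le> s")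
    case True then show ?thesis using key[of t s] assms(3) assms(4)[symmetric] by simp
  next
    case False then show ?thesis
      using key[of s t] assms(4)[symmetric] \<open>t < M\<close> by (simp add: power2_commute)
  qed
qed

lemma block_eq_interval: "0 < N \<Longrightarrow> {t. t div N = (q::nat)} = {q * N..<q * N + N}"
proof (intro equalityI subsetI)
  fix t assume N: "0 < N" and t: "t \<in> {t. t div N = q}"
  have "t = q * N + t mod N" using t by (metis div_mult_mod_eq mem_Collect_eq)
  moreover have "t mod N < N" using N by simp
  ultimately show "t \<in> {q * N..<q * N + N}" by simp
next
  fix t assume N: "0 < N" and t: "t \<in> {q * N..<q * N + N}"
  then show "t \<in> {t. t div N = q}"
    using div_nat_eqI[of N q t] by (simp add: mult.commute add.commute)
qed

text \<open>Compare \<open>v x\<close> with the \<open>N\<close> values in its block, at the cost of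
  \<open>N\<close> times the Dirichlet sum, and average. The resulting first-order norm is dominated
  after expanding the square of \<open>v + N\<^sup>2 * nlap v\<close>, whose cross term is the
  Dirichlet form and hence nonnegative.\<close>

lemma sobolev_line:
  assumes "0 < N" "N dvd M" "x \<mu> < M"
  shows "(v x)\<^sup>2 \<le> 2 / N * (\<Sum>t<M. (v (x(\<mu> := t)) + (real N)\<^sup>2 * nlap M \<mu> v (x(\<mu> := t)))\<^sup>2)"
proof -
  define p where "p t = v (x(\<mu> := t))" for t
  define S where "S = (\<lambda>t. x(\<mu> := t)) ` {..<M}"
  define q where "q = x \<mu> div N"
  define E where "E = (\<Sum>r | Suc r < M. (p (Suc r) - p r)\<^sup>2)"
  let ?n = "real N" and ?l = "nlap M \<mu> v"
  have lc: "line_closed M \<mu> S" unfolding S_def using assms by (intro line_closed_line)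
  have inj: "inj_on (\<lambda>t. x(\<mu> := t)) A" for A by (rule inj_onI) (metis fun_upd_same)
  have sumS: "(\<Sum>y\<in>S. f y) = (\<Sum>t<M. f (x(\<mu> := t)))" for f :: "_ \<Rightarrow> real"
    unfolding S_def by (subst sum.reindex[OF inj]) simp
  have fM: "finite {r. Suc r < M}" by (rule finite_subset[of _ "{..<M}"]) auto
  have edgesS: "edges M \<mu> S = (\<lambda>t. x(\<mu> := t)) ` {r. Suc r < M}"
    by (auto simp: edges_def S_def)
  have E_eq: "(\<Sum>y\<in>S. v y * ?l y) = E"
    unfolding sum_nlap_by_parts[OF lc] edgesS E_def p_def
    by (subst sum.reindex[OF inj]) (simp add: fdiff_def power2_eq_square)
  have E0: "0 \<le> E" unfolding E_def by (simp add: sum_nonneg)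
  have blk: "{t. t div N = q} \<subseteq> {..<M}" using block_less[OF assms] by (auto simp: q_def)
  have cardq: "card {t. t div N = q} = N" using assms by (simp add: block_eq_interval)
  have pt: "(v x)\<^sup>2 \<le> 2 * (p t)\<^sup>2 + 2 * (?n * E)" if "t div N = q" for t
  proof -
    have "(p (x \<mu>) - p t)\<^sup>2 \<le> ?n * (\<Sum>r | r div N = x \<mu> div N \<and> Suc r < M. (p (Suc r) - p r)\<^sup>2)"
      using assms that by (intro square_diff_le_block) (auto simp: q_def)
    also have "\<dots> \<le> ?n * E"
      unfolding E_def by (intro mult_left_mono sum_mono2[OF fM]) auto
    finally have 1: "(v x - p t)\<^sup>2 \<le> ?n * E" by (simp add: p_def)
    \<comment> \<open>This square equals
      \<open>2 * (p t)\<^sup>2 + 2 * (v x - p t)\<^sup>2 - (v x)\<^sup>2\<close>.\<close>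
    have "0 \<le> (v x - 2 * p t)\<^sup>2" by simp
    then show ?thesis using 1 by (simp add: power2_eq_square algebra_simps)
  qed
  have "N * (v x)\<^sup>2 = (\<Sum>t | t div N = q. (v x)\<^sup>2)" by (simp add: cardq)
  also have "\<dots> \<le> (\<Sum>t | t div N = q. 2 * (p t)\<^sup>2 + 2 * (?n * E))"
    by (intro sum_mono pt) auto
  also have "\<dots> = 2 * (\<Sum>t | t div N = q. (p t)\<^sup>2) + 2 * ?n\<^sup>2 * E"
    by (simp add: sum.distrib sum_distrib_left cardq power2_eq_square)
  also have "\<dots> \<le> 2 * (\<Sum>t<M. (p t)\<^sup>2) + 2 * ?n\<^sup>2 * E"
    using sum_mono2[OF _ blk, of "\<lambda>t. (p t)\<^sup>2"] by simp
  also have "\<dots> = 2 * ((\<Sum>y\<in>S. (v y)\<^sup>2) + ?n\<^sup>2 * (\<Sum>y\<in>S. v y * ?l y))"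
    by (simp add: sumS p_def E_eq[unfolded sumS] distrib_left)
  also have "\<dots> \<le> 2 * ((\<Sum>y\<in>S. (v y)\<^sup>2) + 2 * (?n\<^sup>2 * (\<Sum>y\<in>S. v y * ?l y)) + ?n^4 * (\<Sum>y\<in>S. (?l y)\<^sup>2))"
  proof -
    have "0 \<le> ?n\<^sup>2 * (\<Sum>y\<in>S. v y * ?l y)" using E0 E_eq by simp
    moreover have "0 \<le> ?n^4 * (\<Sum>y\<in>S. (?l y)\<^sup>2)" by (simp add: sum_nonneg)
    moreover have "2 * (s + p) \<le> 2 * (s + 2 * p + q)" if "0 \<le> p" "0 \<le> q" for s p q :: real
      using that by simp
    ultimately show ?thesis by blast
  qed
  also have "\<dots> = 2 * (\<Sum>y\<in>S. (v y + ?n\<^sup>2 * ?l y)\<^sup>2)"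
  proof -
    have "(v y + ?n\<^sup>2 * ?l y)\<^sup>2 = (v y)\<^sup>2 + 2 * (?n\<^sup>2 * (v y * ?l y)) + ?n^4 * (?l y)\<^sup>2" for y
      by (simp add: power2_sum power_mult_distrib)
    then show ?thesis by (simp add: sum.distrib flip: sum_distrib_left)
  qed
  finally have "N * (v x)\<^sup>2 \<le> 2 * (\<Sum>y\<in>S. (v y + ?n\<^sup>2 * ?l y)\<^sup>2)" .
  then have "(v x)\<^sup>2 \<le> 2 * (\<Sum>y\<in>S. (v y + ?n\<^sup>2 * ?l y)\<^sup>2) / N"
    using assms by (simp add: pos_le_divide_eq mult.commute)
  then show ?thesis by (simp add: sumS)
qed

section \<open>Block averages and the Poincare inequality\<close>

definition cell :: "nat \<Rightarrow> nat \<Rightarrow> nat \<Rightarrow> (nat \<Rightarrow> nat) \<Rightarrow> (nat \<Rightarrow> nat) set" where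
  "cell d N M x = {y \<in> cube d M. \<forall>\<mu><d. y \<mu> div N = x \<mu> div N}"

text \<open>This is the composition of Q with its adjoint, read as a function on the fine lattice,
  so that the coarse lattice never has to appear.\<close>

definition avg :: "nat \<Rightarrow> nat \<Rightarrow> nat \<Rightarrow> ((nat \<Rightarrow> nat) \<Rightarrow> real) \<Rightarrow> (nat \<Rightarrow> nat) \<Rightarrow> real" where
  "avg d N M g x = (\<Sum>y\<in>cell d N M x. g y) / real N ^ d"

definition dirichlet :: "nat \<Rightarrow> nat \<Rightarrow> ((nat \<Rightarrow> nat) \<Rightarrow> real) \<Rightarrow> real" where
  "dirichlet d M v = (\<Sum>\<mu><d. \<Sum>x\<in>edges M \<mu> (cube d M). (fdiff \<mu> v x)\<^sup>2)"

lemma finite_cell [simp]: "finite (cell d N M x)"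
  by (simp add: cell_def)

lemma card_cell:
  assumes "0 < N" "N dvd M" "x \<in> cube d M"
  shows "card (cell d N M x) = N ^ d"
proof -
  have "cell d N M x = gbox d (\<lambda>\<mu>. {t. t div N = x \<mu> div N})"
    using block_less[OF assms(1,2) cube_less[OF assms(3)]]
    by (auto simp: cell_def cube_def gbox_def)
  then show ?thesis using assms by (simp add: card_gbox block_eq_interval)
qed

lemma sum_cells_swap:
  fixes f :: "_ \<Rightarrow> _ \<Rightarrow> real"
  shows "(\<Sum>x\<in>cube d M. \<Sum>y\<in>cell d N M x. f x y) = (\<Sum>x\<in>cube d M. \<Sum>y\<in>cell d N M x. f y x)"
  unfolding sum.Sigma[OF finite_cube ballI[OF finite_cell]]
  by (rule sum.reindex_bij_witness[of _ prod.swap prod.swap]) (auto simp: cell_def)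

lemma sum_cells_fst:
  assumes "0 < N" "N dvd M"
  shows "(\<Sum>x\<in>cube d M. \<Sum>y\<in>cell d N M x. f x) = real N ^ d * (\<Sum>x\<in>cube d M. f x)"
  using assms by (simp add: card_cell sum_distrib_left)

lemma sum_avg: "(\<Sum>x\<in>cube d M. f x * avg d N M g x)
    = (\<Sum>x\<in>cube d M. \<Sum>y\<in>cell d N M x. f x * g y) / real N ^ d"
  by (simp add: avg_def sum_distrib_left sum_divide_distrib)

lemma avg_lincomb: "avg d N M (\<lambda>y. c * f y + g y) x = c * avg d N M f x + avg d N M g x"
  by (simp add: avg_def sum.distrib sum_distrib_left add_divide_distrib)

text \<open>Exchanging the coordinate \<open>x j\<close> with \<open>r\<close> turns the pairs into
  an edge together with a forgotten coordinate in the same block, so every edge is counted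
  \<open>N\<close> times.\<close>

lemma poincare_direction:
  assumes N: "0 < N" "N dvd M" and j: "j < d"
  shows "(\<Sum>x\<in>cube d M. \<Sum>r | r div N = x j div N \<and> Suc r < M. (fdiff j v (x(j := r)))\<^sup>2)
      = real N * (\<Sum>x\<in>edges M j (cube d M). (fdiff j v x)\<^sup>2)"
proof -
  have fin: "finite {r. r div N = q \<and> Suc r < M}" for q
    by (rule finite_subset[of _ "{..<M}"]) auto
  have finb: "finite {r. r div N = (q::nat)}" for q
    using N by (simp add: block_eq_interval)
  have "(\<Sum>x\<in>cube d M. \<Sum>r | r div N = x j div N \<and> Suc r < M. (fdiff j v (x(j := r)))\<^sup>2)
      = (\<Sum>x\<in>edges M j (cube d M). \<Sum>r | r div N = x j div N. (fdiff j v x)\<^sup>2)"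
    unfolding sum.Sigma[OF finite_cube ballI[OF fin]] sum.Sigma[OF finite_edges[OF finite_cube] ballI[OF finb]]
    using j block_less[OF N] cube_less[of _ d M j]
    by (intro sum.reindex_bij_witness[of _ "\<lambda>(x, r). (x(j := r), x j)" "\<lambda>(x, r). (x(j := r), x j)"])
      (auto simp: edges_def intro!: cube_upd)
  also have "\<dots> = (\<Sum>x\<in>edges M j (cube d M). real N * (fdiff j v x)\<^sup>2)"
    using N by (simp add: block_eq_interval)
  finally show ?thesis by (simp add: sum_distrib_left)
qed

lemma poincare_cells:
  assumes N: "0 < N" "N dvd M"
  shows "(\<Sum>x\<in>cube d M. (v x)\<^sup>2)
     \<le> (\<Sum>x\<in>cube d M. v x * avg d N M v x) + d / 2 * (real N)\<^sup>2 * dirichlet d M v"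
proof -
  \<comment> \<open>telescope from \<open>x\<close> to \<open>y\<close> one coordinate at a time; exchanging the first \<open>j\<close> coordinates
   of \<open>x\<close> and \<open>y\<close> is an involution on pairs in a common cell\<close>
  define hyb :: "nat \<Rightarrow> (nat \<Rightarrow> nat) \<Rightarrow> (nat \<Rightarrow> nat) \<Rightarrow> nat \<Rightarrow> nat"
    where "hyb j x y = (\<lambda>\<mu>. if \<mu> < j then y \<mu> else x \<mu>)" for j x y
  define F where "F j x = (\<Sum>r | r div N = x j div N \<and> Suc r < M. (fdiff j v (x(j := r)))\<^sup>2)" for j x
  let ?B = "cube d M" and ?C = "cell d N M"
  have hyb_sum: "(\<Sum>x\<in>?B. \<Sum>y\<in>?C x. f (hyb j x y)) = (\<Sum>x\<in>?B. \<Sum>y\<in>?C x. f x)"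
    for f :: "_ \<Rightarrow> real" and j
    unfolding sum.Sigma[OF finite_cube ballI[OF finite_cell]]
    by (rule sum.reindex_bij_witness[of _ "\<lambda>(x, y). (hyb j x y, hyb j y x)" "\<lambda>(x, y). (hyb j x y, hyb j y x)"])
      (auto simp: hyb_def cell_def cube_def gbox_def fun_eq_iff)
  have step: "(v (hyb j x y) - v (hyb (Suc j) x y))\<^sup>2 \<le> N * F j (hyb j x y)"
    if j: "j < d" and x: "x \<in> ?B" and y: "y \<in> ?C x" for j x y
  proof -
    let ?h = "hyb j x y" and ?p = "\<lambda>t. v ((hyb j x y)(j := t))"
    have "hyb (Suc j) x y = ?h(j := y j)" by (auto simp: hyb_def fun_eq_iff)
    moreover have "v ?h = ?p (x j)" by (simp add: hyb_def fun_upd_idem)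
    moreover have "(?p (x j) - ?p (y j))\<^sup>2
        \<le> N * (\<Sum>r | r div N = x j div N \<and> Suc r < M. (?p (Suc r) - ?p r)\<^sup>2)"
      using N cube_less[OF x j] y j by (intro square_diff_le_block) (auto simp: cell_def)
    ultimately show ?thesis by (simp add: F_def fdiff_def hyb_def)
  qed
  have "(v x - v y)\<^sup>2 \<le> real d * (\<Sum>j<d. N * F j (hyb j x y))" if x: "x \<in> ?B" and y: "y \<in> ?C x" for x y
  proof -
    have "hyb 0 x y = x" by (simp add: hyb_def)
    moreover have "hyb d x y = y" using x y by (auto simp: hyb_def cell_def cube_def gbox_def)
    ultimately have "v x - v y = (\<Sum>j<d. v (hyb j x y) - v (hyb (Suc j) x y))"
      using sum_lessThan_telescope'[of "\<lambda>j. v (hyb j x y)" d] by simp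
    then have "(v x - v y)\<^sup>2 \<le> (\<Sum>j<d. (v (hyb j x y) - v (hyb (Suc j) x y))\<^sup>2) * card {..<d}"
      using sum_squared_le_sum_of_squares by metis
    also have "\<dots> \<le> (\<Sum>j<d. N * F j (hyb j x y)) * card {..<d}"
      using step[OF _ x y] by (intro mult_right_mono sum_mono) auto
    finally show ?thesis by (simp add: mult.commute)
  qed
  then have "(\<Sum>x\<in>?B. \<Sum>y\<in>?C x. (v x - v y)\<^sup>2)
      \<le> (\<Sum>x\<in>?B. \<Sum>y\<in>?C x. real d * (\<Sum>j<d. N * F j (hyb j x y)))"
    by (intro sum_mono) auto
  also have "\<dots> = (\<Sum>x\<in>?B. \<Sum>j<d. \<Sum>y\<in>?C x. real d * (N * F j (hyb j x y)))"
    by (simp only: sum_distrib_left sum.swap[of _ "?C _" "{..<d}"])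
  also have "\<dots> = (\<Sum>j<d. \<Sum>x\<in>?B. \<Sum>y\<in>?C x. real d * (N * F j (hyb j x y)))"
    by (rule sum.swap)
  also have "\<dots> = (\<Sum>j<d. \<Sum>x\<in>?B. \<Sum>y\<in>?C x. real d * (N * F j x))"
    by (intro sum.cong refl hyb_sum[where f = "\<lambda>x. real d * (N * F j x)" for j])
  also have "\<dots> = (\<Sum>j<d. real N ^ d * (\<Sum>x\<in>?B. real d * (N * F j x)))"
    by (simp only: sum_cells_fst[OF N])
  also have "\<dots> = (\<Sum>j<d. real N ^ d * (real d * N * (\<Sum>x\<in>?B. F j x)))"
    by (simp add: sum_distrib_left mult.assoc)
  also have "\<dots> = (\<Sum>j<d. real N ^ d * (real d * N * (N * (\<Sum>x\<in>edges M j ?B. (fdiff j v x)\<^sup>2))))"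
    using poincare_direction[OF N] by (intro sum.cong) (auto simp: F_def)
  also have "\<dots> = real N ^ d * (d * (real N)\<^sup>2 * dirichlet d M v)"
    by (simp add: dirichlet_def sum_distrib_left power2_eq_square mult.assoc)
  finally have 1: "(\<Sum>x\<in>?B. \<Sum>y\<in>?C x. (v x - v y)\<^sup>2) \<le> real N ^ d * (d * (real N)\<^sup>2 * dirichlet d M v)" .
  \<comment> \<open>Variance identity: the sum of squared differences over pairs in a common cell is
    \<open>2 * N ^ d\<close> times the squared norm minus the form of the averaging.\<close>
  have "(\<Sum>x\<in>?B. \<Sum>y\<in>?C x. (v x - v y)\<^sup>2)
      = (\<Sum>x\<in>?B. \<Sum>y\<in>?C x. (v x)\<^sup>2) + (\<Sum>x\<in>?B. \<Sum>y\<in>?C x. (v y)\<^sup>2)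
        - 2 * (\<Sum>x\<in>?B. \<Sum>y\<in>?C x. v x * v y)"
    by (simp add: power2_diff sum.distrib sum_subtractf sum_distrib_left mult.assoc)
  also have "\<dots> = real N ^ d * (2 * (\<Sum>x\<in>?B. (v x)\<^sup>2) - 2 * (\<Sum>x\<in>?B. v x * avg d N M v x))"
    unfolding sum_avg sum_cells_swap[of "\<lambda>x y. (v y)\<^sup>2"] sum_cells_fst[OF N]
    using N by (simp add: right_diff_distrib)
  finally have "real N ^ d * (2 * (\<Sum>x\<in>?B. (v x)\<^sup>2) - 2 * (\<Sum>x\<in>?B. v x * avg d N M v x))
      \<le> real N ^ d * (d * (real N)\<^sup>2 * dirichlet d M v)" using 1 by simp
  then show ?thesis using N by simp
qed

section \<open>The weighted energy estimate\<close>

text \<open>The operator to be inverted, acting on real functions. Free coefficients allow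
  \<open>b = 0\<close> as well, which yields the comparison operator without averaging.\<close>

definition block_op :: "nat \<Rightarrow> nat \<Rightarrow> nat \<Rightarrow> real \<Rightarrow> real \<Rightarrow> ((nat \<Rightarrow> nat) \<Rightarrow> real) \<Rightarrow> (nat \<Rightarrow> nat) \<Rightarrow> real"
  where "block_op d N M m b g x = (real N)\<^sup>2 * (\<Sum>\<nu><d. nlap M \<nu> g x) + m * g x + b * avg d N M g x"

lemma block_op_lincomb:
  "block_op d N M m b (\<lambda>y. c * f y + g y) x = c * block_op d N M m b f x + block_op d N M m b g x"
  unfolding block_op_def nlap_lincomb avg_lincomb sum.distrib sum_distrib_left[symmetric]
  by (simp add: algebra_simps)

lemma exp_add_exp_minus_le:
  fixes t :: real
  assumes "\<bar>t\<bar> \<le> 1"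
  shows "exp t + exp (-t) - 2 \<le> 2 * t\<^sup>2"
proof -
  have "exp s \<le> 1 + s + s\<^sup>2" if "\<bar>s\<bar> \<le> 1" for s :: real
  proof (cases "0 \<le> s")
    case True then show ?thesis using exp_bound[of s] that by simp
  next
    case False
    \<comment> \<open>For negative \<open>s\<close> the bound passes through
      \<open>exp s \<le> 1 / (1 - s)\<close>; the product here is \<open>1 - s ^ 3\<close>, which is
      at least 1.\<close>
    have "(1 + s + s\<^sup>2) * (1 - s) = 1 + (- s) * s\<^sup>2" by (simp add: algebra_simps power2_eq_square)
    also have "\<dots> \<ge> 1" using False by (simp add: mult_nonpos_nonneg)
    finally have "1 / (1 - s) \<le> 1 + s + s\<^sup>2" using False by (simp add: pos_divide_le_eq)
    moreover have "1 - s \<le> exp (- s)" using exp_ge_add_one_self[of "-s"] by simp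
    then have "exp s \<le> 1 / (1 - s)"
      using False by (simp add: exp_minus field_simps)
    ultimately show ?thesis by simp
  qed
  from this[of t] this[of "-t"] assms show ?thesis by simp
qed

lemma exp_weight_diff:
  fixes p q s :: real
  assumes "\<bar>p - q\<bar> \<le> s" "s \<le> 1"
  shows "(exp p - exp q)\<^sup>2 \<le> 2 * s\<^sup>2 * (exp p * exp q)"
proof -
  have "(exp p - exp q)\<^sup>2 = exp p * exp q * (exp (p - q) + exp (- (p - q)) - 2)"
    by (simp add: exp_diff power2_eq_square field_simps)
  also have "\<dots> \<le> exp p * exp q * (2 * (p - q)\<^sup>2)"
    using assms exp_add_exp_minus_le[of "p - q"] by (intro mult_left_mono) auto
  also have "\<dots> \<le> exp p * exp q * (2 * s\<^sup>2)"
    using assms by (intro mult_left_mono) (auto simp: abs_le_square_iff[symmetric])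
  finally show ?thesis by (simp add: mult_ac)
qed

text \<open>The common form of the conjugation error in both energy estimates, for an edge and for a
  pair of sites in one cell. It is quadratic in the variation \<open>s\<close> of the
  exponent.\<close>

lemma weighted_product_bound:
  fixes p q s a b :: real
  assumes "\<bar>p - q\<bar> \<le> s" "s \<le> 1"
  shows "\<bar>(exp p - exp q)\<^sup>2 * (a * b)\<bar> \<le> s\<^sup>2 * ((exp p * a)\<^sup>2 + (exp q * b)\<^sup>2)"
proof -
  have "\<bar>(exp p - exp q)\<^sup>2 * (a * b)\<bar> = (exp p - exp q)\<^sup>2 * \<bar>a * b\<bar>" by (simp add: abs_mult)
  also have "\<dots> \<le> 2 * s\<^sup>2 * (exp p * exp q) * \<bar>a * b\<bar>"
    by (intro mult_right_mono exp_weight_diff assms) simp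
  also have "\<dots> = s\<^sup>2 * (2 * \<bar>exp p * a\<bar> * \<bar>exp q * b\<bar>)" by (simp add: abs_mult mult_ac)
  also have "\<dots> \<le> s\<^sup>2 * ((exp p * a)\<^sup>2 + (exp q * b)\<^sup>2)"
    using sum_squares_bound[of "\<bar>exp p * a\<bar>" "\<bar>exp q * b\<bar>"] by (intro mult_left_mono) auto
  finally show ?thesis .
qed

text \<open>First-order commutator terms cancel, leaving an error quadratic in the slope
  \<open>s\<close>. For slope \<open>\<delta> / N\<close> this compensates the factor
  \<open>N\<^sup>2\<close> of the Laplacian. The 2 arises because a site is an endpoint of at most
  two edges in one direction.\<close>

lemma energy_nlap:
  assumes \<mu>: "\<mu> < d" and s: "s \<le> 1"
    and \<phi>: "\<And>x. x \<in> edges M \<mu> (cube d M) \<Longrightarrow> \<bar>fdiff \<mu> \<phi> x\<bar> \<le> s"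
  shows "(\<Sum>x\<in>edges M \<mu> (cube d M). (fdiff \<mu> (\<lambda>x. exp (\<phi> x) * g x) x)\<^sup>2)
      - 2 * s\<^sup>2 * (\<Sum>x\<in>cube d M. (exp (\<phi> x) * g x)\<^sup>2)
    \<le> (\<Sum>x\<in>cube d M. (exp (\<phi> x))\<^sup>2 * g x * nlap M \<mu> g x)"
proof -
  let ?B = "cube d M" and ?w = "\<lambda>x. exp (\<phi> x)" and ?v = "\<lambda>x. exp (\<phi> x) * g x"
  let ?E = "edges M \<mu> ?B" and ?up = "\<lambda>x. x(\<mu> := Suc (x \<mu>))"
  have lc: "line_closed M \<mu> ?B" using \<mu> by (rule line_closed_cube)
  have pt: "(fdiff \<mu> ?v x)\<^sup>2 - s\<^sup>2 * ((?v (?up x))\<^sup>2 + (?v x)\<^sup>2) \<le> fdiff \<mu> (\<lambda>x. (?w x)\<^sup>2 * g x) x * fdiff \<mu> g x"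
    if x: "x \<in> ?E" for x
  proof -
    have id: "fdiff \<mu> (\<lambda>x. (?w x)\<^sup>2 * g x) x * fdiff \<mu> g x
        = (fdiff \<mu> ?v x)\<^sup>2 - (?w (?up x) - ?w x)\<^sup>2 * (g (?up x) * g x)"
      by (simp add: fdiff_def power2_eq_square algebra_simps)
    have "\<bar>(?w (?up x) - ?w x)\<^sup>2 * (g (?up x) * g x)\<bar> \<le> s\<^sup>2 * ((?v (?up x))\<^sup>2 + (?v x)\<^sup>2)"
      using \<phi>[OF x] s by (intro weighted_product_bound) (auto simp: fdiff_def)
    then show ?thesis unfolding id by linarith
  qed
  have 1: "(\<Sum>x\<in>?E. (?v (?up x))\<^sup>2) \<le> (\<Sum>x\<in>?B. (?v x)\<^sup>2)"
    unfolding sum_shift_edges[OF lc, of "\<lambda>x. (?v x)\<^sup>2", symmetric] by (intro sum_mono2) auto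
  have 2: "(\<Sum>x\<in>?E. (?v x)\<^sup>2) \<le> (\<Sum>x\<in>?B. (?v x)\<^sup>2)"
    by (intro sum_mono2) (auto simp: edges_def)
  have "s\<^sup>2 * ((\<Sum>x\<in>?E. (?v (?up x))\<^sup>2) + (\<Sum>x\<in>?E. (?v x)\<^sup>2)) \<le> s\<^sup>2 * (2 * (\<Sum>x\<in>?B. (?v x)\<^sup>2))"
    using 1 2 by (intro mult_left_mono) auto
  moreover have "(\<Sum>x\<in>?E. (fdiff \<mu> ?v x)\<^sup>2) - s\<^sup>2 * ((\<Sum>x\<in>?E. (?v (?up x))\<^sup>2) + (\<Sum>x\<in>?E. (?v x)\<^sup>2))
      = (\<Sum>x\<in>?E. (fdiff \<mu> ?v x)\<^sup>2 - s\<^sup>2 * ((?v (?up x))\<^sup>2 + (?v x)\<^sup>2))"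
    by (simp only: sum_subtractf sum_distrib_left[symmetric] sum.distrib)
  moreover have "\<dots> \<le> (\<Sum>x\<in>?E. fdiff \<mu> (\<lambda>x. (?w x)\<^sup>2 * g x) x * fdiff \<mu> g x)"
    by (rule sum_mono[OF pt])
  moreover have "\<dots> = (\<Sum>x\<in>?B. (?w x)\<^sup>2 * g x * nlap M \<mu> g x)"
    by (rule sum_nlap_by_parts[OF lc, symmetric])
  ultimately show ?thesis by simp
qed

lemma energy_avg:
  assumes N: "0 < N" "N dvd M" and s: "s \<le> 1"
    and \<phi>: "\<And>x y. x \<in> cube d M \<Longrightarrow> y \<in> cell d N M x \<Longrightarrow> \<bar>\<phi> x - \<phi> y\<bar> \<le> s"
  shows "(\<Sum>x\<in>cube d M. exp (\<phi> x) * g x * avg d N M (\<lambda>x. exp (\<phi> x) * g x) x)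
      - s\<^sup>2 * (\<Sum>x\<in>cube d M. (exp (\<phi> x) * g x)\<^sup>2)
    \<le> (\<Sum>x\<in>cube d M. (exp (\<phi> x))\<^sup>2 * g x * avg d N M g x)"
proof -
  let ?B = "cube d M" and ?C = "cell d N M" and ?w = "\<lambda>x. exp (\<phi> x)"
  let ?S = "\<lambda>f. \<Sum>x\<in>?B. \<Sum>y\<in>?C x. f x y :: real"
  have "2 * ?S (\<lambda>x y. (?w x)\<^sup>2 * g x * g y)
      = ?S (\<lambda>x y. (?w x)\<^sup>2 * g x * g y) + ?S (\<lambda>x y. (?w y)\<^sup>2 * g y * g x)"
    using sum_cells_swap[where f = "\<lambda>x y. (?w x)\<^sup>2 * g x * g y"] by simp
  also have "\<dots> = ?S (\<lambda>x y. (?w x)\<^sup>2 * g x * g y + (?w y)\<^sup>2 * g y * g x)"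
    by (simp only: sum.distrib)
  \<comment> \<open>Symmetrising in \<open>x\<close> and \<open>y\<close> is what removes the
    first-order error, as in the differential case.\<close>
  also have "\<dots> = ?S (\<lambda>x y. 2 * (?w x * g x * (?w y * g y)) + (?w x - ?w y)\<^sup>2 * (g x * g y))"
    by (intro sum.cong) (auto simp: power2_eq_square algebra_simps)
  also have "\<dots> \<ge> ?S (\<lambda>x y. 2 * (?w x * g x * (?w y * g y)) - s\<^sup>2 * ((?w x * g x)\<^sup>2 + (?w y * g y)\<^sup>2))"
  proof (intro sum_mono)
    fix x y assume "x \<in> ?B" "y \<in> ?C x"
    from weighted_product_bound[OF \<phi>[OF this] s, of "g x" "g y"]
    show "2 * (?w x * g x * (?w y * g y)) - s\<^sup>2 * ((?w x * g x)\<^sup>2 + (?w y * g y)\<^sup>2)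
       \<le> 2 * (?w x * g x * (?w y * g y)) + (?w x - ?w y)\<^sup>2 * (g x * g y)" by linarith
  qed
  also have "?S (\<lambda>x y. 2 * (?w x * g x * (?w y * g y)) - s\<^sup>2 * ((?w x * g x)\<^sup>2 + (?w y * g y)\<^sup>2))
      = 2 * ?S (\<lambda>x y. ?w x * g x * (?w y * g y))
        - s\<^sup>2 * (?S (\<lambda>x y. (?w x * g x)\<^sup>2) + ?S (\<lambda>x y. (?w y * g y)\<^sup>2))"
    by (simp only: sum_subtractf sum_distrib_left[symmetric] sum.distrib)
  also have "\<dots> = 2 * (?S (\<lambda>x y. ?w x * g x * (?w y * g y)) - real N ^ d * (s\<^sup>2 * (\<Sum>x\<in>?B. (?w x * g x)\<^sup>2)))"
    unfolding sum_cells_swap[of "\<lambda>x y. (?w y * g y)\<^sup>2"] sum_cells_fst[OF N] by (simp add: algebra_simps)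
  finally have "?S (\<lambda>x y. ?w x * g x * (?w y * g y)) - real N ^ d * (s\<^sup>2 * (\<Sum>x\<in>?B. (?w x * g x)\<^sup>2))
      \<le> ?S (\<lambda>x y. (?w x)\<^sup>2 * g x * g y)" by simp
  then have "(?S (\<lambda>x y. ?w x * g x * (?w y * g y)) - real N ^ d * (s\<^sup>2 * (\<Sum>x\<in>?B. (?w x * g x)\<^sup>2))) / real N ^ d
      \<le> ?S (\<lambda>x y. (?w x)\<^sup>2 * g x * g y) / real N ^ d" by (intro divide_right_mono) auto
  then show ?thesis unfolding sum_avg diff_divide_distrib using N by simp
qed

text \<open>Averaging is a self-adjoint idempotent, so its form is the squared norm of the averaged
  function.\<close>

lemma sum_avg_nonneg:
  assumes "0 < N" "N dvd M"
  shows "0 \<le> (\<Sum>x\<in>cube d M. v x * avg d N M v x)"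
proof -
  let ?A = "avg d N M v" and ?C = "cell d N M"
  have "?A y = ?A x" if "y \<in> ?C x" for x y
  proof -
    have "?C y = ?C x" using that by (auto simp: cell_def)
    then show ?thesis by (simp add: avg_def)
  qed
  then have "(\<Sum>x\<in>cube d M. \<Sum>y\<in>?C x. v x * ?A y) = (\<Sum>x\<in>cube d M. \<Sum>y\<in>?C x. v x * ?A x)"
    by (intro sum.cong) auto
  also have "\<dots> = real N ^ d * (\<Sum>x\<in>cube d M. v x * ?A x)"
    using assms by (rule sum_cells_fst)
  also have "(\<Sum>x\<in>cube d M. \<Sum>y\<in>?C x. v x * ?A y) = (\<Sum>x\<in>cube d M. \<Sum>y\<in>?C x. ?A x * v y)"
    by (subst sum_cells_swap) (simp add: mult.commute)
  finally have "(\<Sum>x\<in>cube d M. v x * ?A x) = (\<Sum>x\<in>cube d M. ?A x * ?A x)"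
    using assms sum_avg[where f = ?A and g = v and d = d and N = N and M = M] by (simp add: field_simps)
  then show ?thesis by (simp add: sum_nonneg)
qed

text \<open>Only the share \<kappa> of the averaging term is used:
  \<open>\<kappa> * d \<le> 2\<close> lets the Dirichlet energy absorb the gradient term of
  Poincare, giving coercivity \<kappa>. The conjugation errors
  \<open>2 * d * \<delta>\<^sup>2\<close> (Laplacian) and
  \<open>d\<^sup>2 * \<delta>\<^sup>2\<close> (averaging) may consume half of it.\<close>

lemma energy_block_op:
  assumes N: "0 < N" "N dvd M" and m: "0 \<le> m" and b: "b \<le> 1" "\<kappa> \<le> b" "0 < \<kappa>" "\<kappa> * d \<le> 2"
    and \<delta>: "0 \<le> \<delta>" "\<delta> * d \<le> 1" "\<delta> \<le> 1" "(2 * d + (real d)\<^sup>2) * \<delta>\<^sup>2 \<le> \<kappa> / 2"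
    and edge: "\<And>\<nu> x. \<nu> < d \<Longrightarrow> x \<in> edges M \<nu> (cube d M) \<Longrightarrow> \<bar>fdiff \<nu> \<phi> x\<bar> \<le> \<delta> / N"
    and cell: "\<And>x y. x \<in> cube d M \<Longrightarrow> y \<in> cell d N M x \<Longrightarrow> \<bar>\<phi> x - \<phi> y\<bar> \<le> \<delta> * d"
  shows "\<kappa> / 2 * (\<Sum>x\<in>cube d M. (exp (\<phi> x) * g x)\<^sup>2)
     \<le> (\<Sum>x\<in>cube d M. (exp (\<phi> x))\<^sup>2 * g x * block_op d N M m b g x)"
proof -
  let ?B = "cube d M" and ?w = "\<lambda>x. exp (\<phi> x)"
  define v where "v x = exp (\<phi> x) * g x" for x
  define V where "V = (\<Sum>x\<in>?B. (v x)\<^sup>2)"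
  define P where "P = (\<Sum>x\<in>?B. v x * avg d N M v x)"
  define E where "E = (real N)\<^sup>2 * dirichlet d M v"
  have V0: "0 \<le> V" by (simp add: V_def sum_nonneg)
  have P0: "0 \<le> P" unfolding P_def by (rule sum_avg_nonneg[OF N])
  have E0: "0 \<le> E" by (simp add: E_def dirichlet_def sum_nonneg)
  have 1: "E - 2 * d * \<delta>\<^sup>2 * V \<le> (real N)\<^sup>2 * (\<Sum>\<nu><d. \<Sum>x\<in>?B. (?w x)\<^sup>2 * g x * nlap M \<nu> g x)"
  proof -
    have "\<delta> / N \<le> 1"
    proof -
      have "\<delta> / N \<le> \<delta> / 1" using N \<delta> by (intro divide_left_mono) auto
      then show ?thesis using \<delta> by simp
    qed
    then have "(\<Sum>\<nu><d. (\<Sum>x\<in>edges M \<nu> ?B. (fdiff \<nu> v x)\<^sup>2) - 2 * (\<delta> / N)\<^sup>2 * V)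
        \<le> (\<Sum>\<nu><d. \<Sum>x\<in>?B. (?w x)\<^sup>2 * g x * nlap M \<nu> g x)"
      unfolding v_def V_def using edge by (intro sum_mono energy_nlap) auto
    then have "(real N)\<^sup>2 * (dirichlet d M v - d * (2 * (\<delta> / N)\<^sup>2 * V))
        \<le> (real N)\<^sup>2 * (\<Sum>\<nu><d. \<Sum>x\<in>?B. (?w x)\<^sup>2 * g x * nlap M \<nu> g x)"
      by (intro mult_left_mono) (auto simp: dirichlet_def sum_subtractf)
    then show ?thesis using N by (simp add: E_def right_diff_distrib power_divide mult_ac)
  qed
  have "P - (\<delta> * d)\<^sup>2 * V \<le> (\<Sum>x\<in>?B. (?w x)\<^sup>2 * g x * avg d N M g x)"
    unfolding P_def V_def v_def using \<delta> cell by (intro energy_avg[OF N]) auto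
  then have 2: "b * (P - (\<delta> * d)\<^sup>2 * V) \<le> b * (\<Sum>x\<in>?B. (?w x)\<^sup>2 * g x * avg d N M g x)"
    using b by (intro mult_left_mono) auto
  have "b * ((\<delta> * d)\<^sup>2 * V) \<le> 1 * ((\<delta> * d)\<^sup>2 * V)"
    using b V0 by (intro mult_right_mono) auto
  moreover have "\<kappa> * P \<le> b * P" using b P0 by (intro mult_right_mono) auto
  ultimately have 3: "\<kappa> * P - (real d)\<^sup>2 * \<delta>\<^sup>2 * V \<le> b * (\<Sum>x\<in>?B. (?w x)\<^sup>2 * g x * avg d N M g x)"
    using 2 by (simp add: right_diff_distrib power_mult_distrib mult_ac)
  have "V \<le> P + d / 2 * E"
    using poincare_cells[OF N, of v d] by (simp add: V_def P_def E_def mult_ac)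
  then have "\<kappa> * V \<le> \<kappa> * (P + d / 2 * E)" using b by (intro mult_left_mono) auto
  moreover have "\<kappa> * d * E \<le> 2 * E" using b E0 by (intro mult_right_mono) auto
  ultimately have 4: "\<kappa> * V \<le> \<kappa> * P + E" by (simp add: distrib_left)
  have 5: "(2 * d + (real d)\<^sup>2) * \<delta>\<^sup>2 * V \<le> \<kappa> / 2 * V" using \<delta> V0 by (intro mult_right_mono) auto
  have "0 \<le> m * (\<Sum>x\<in>?B. (?w x)\<^sup>2 * g x * g x)"
    by (rule mult_nonneg_nonneg[OF m sum_nonneg]) (simp add: mult.assoc)
  moreover have "(\<Sum>x\<in>?B. (?w x)\<^sup>2 * g x * block_op d N M m b g x)
      = (real N)\<^sup>2 * (\<Sum>\<nu><d. \<Sum>x\<in>?B. (?w x)\<^sup>2 * g x * nlap M \<nu> g x)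
      + m * (\<Sum>x\<in>?B. (?w x)\<^sup>2 * g x * g x) + b * (\<Sum>x\<in>?B. (?w x)\<^sup>2 * g x * avg d N M g x)"
    unfolding sum.swap[of _ _ "{..<d}"] block_op_def sum_distrib_left sum.distrib[symmetric]
    by (intro sum.cong) (auto simp: distrib_left sum_distrib_left mult_ac)
  ultimately have "E - 2 * d * \<delta>\<^sup>2 * V + (\<kappa> * P - (real d)\<^sup>2 * \<delta>\<^sup>2 * V)
     \<le> (\<Sum>x\<in>?B. (?w x)\<^sup>2 * g x * block_op d N M m b g x)" using 1 3 by linarith
  moreover have "\<kappa> / 2 * V \<le> E - 2 * d * \<delta>\<^sup>2 * V + (\<kappa> * P - (real d)\<^sup>2 * \<delta>\<^sup>2 * V)"
    using 4 5 by (simp add: distrib_right)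
  ultimately show ?thesis by (simp add: V_def v_def)
qed

text \<open>Testing the equation with the solution times the squared weight and applying
  Cauchy-Schwarz puts the same weight on both sides.\<close>

lemma weighted_l2_bound:
  assumes "0 < N" "N dvd M" "0 \<le> m" "b \<le> 1" "\<kappa> \<le> b" "0 < \<kappa>" "\<kappa> * d \<le> 2"
    and "0 \<le> \<delta>" "\<delta> * d \<le> 1" "\<delta> \<le> 1" "(2 * d + (real d)\<^sup>2) * \<delta>\<^sup>2 \<le> \<kappa> / 2"
    and "\<And>\<nu> x. \<nu> < d \<Longrightarrow> x \<in> edges M \<nu> (cube d M) \<Longrightarrow> \<bar>fdiff \<nu> \<phi> x\<bar> \<le> \<delta> / N"
    and "\<And>x y. x \<in> cube d M \<Longrightarrow> y \<in> cell d N M x \<Longrightarrow> \<bar>\<phi> x - \<phi> y\<bar> \<le> \<delta> * d"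
    and f: "\<And>x. x \<in> cube d M \<Longrightarrow> block_op d N M m b g x = f x"
  shows "(\<Sum>x\<in>cube d M. (exp (\<phi> x) * g x)\<^sup>2) \<le> (2 / \<kappa>)\<^sup>2 * (\<Sum>x\<in>cube d M. (exp (\<phi> x) * f x)\<^sup>2)"
proof -
  define V where "V = (\<Sum>x\<in>cube d M. (exp (\<phi> x) * g x)\<^sup>2)"
  define F where "F = (\<Sum>x\<in>cube d M. (exp (\<phi> x) * f x)\<^sup>2)"
  have V0: "0 \<le> V" "0 \<le> F" by (simp_all add: V_def F_def sum_nonneg)
  have "\<kappa> / 2 * V \<le> (\<Sum>x\<in>cube d M. (exp (\<phi> x))\<^sup>2 * g x * block_op d N M m b g x)"
    unfolding V_def by (rule energy_block_op) (fact assms)+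
  also have "\<dots> = (\<Sum>x\<in>cube d M. (exp (\<phi> x) * g x) * (exp (\<phi> x) * f x))"
    by (intro sum.cong) (auto simp: f power2_eq_square)
  finally have "(\<kappa> / 2 * V)\<^sup>2 \<le> (\<Sum>x\<in>cube d M. (exp (\<phi> x) * g x) * (exp (\<phi> x) * f x))\<^sup>2"
    using V0 \<open>0 < \<kappa>\<close> by (intro power_mono) auto
  also have "\<dots> \<le> V * F" unfolding V_def F_def by (rule Cauchy_Schwarz_ineq_sum)
  finally have *: "V * ((\<kappa> / 2)\<^sup>2 * V) \<le> V * F" by (simp add: power2_eq_square mult_ac)
  have "(\<kappa> / 2)\<^sup>2 * V \<le> F"
  proof (cases "V = 0")
    case True then show ?thesis using V0 by simp
  next
    case False
    then show ?thesis using * V0 by simp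
  qed
  then show ?thesis
    using \<open>0 < \<kappa>\<close> by (simp add: V_def F_def field_simps)
qed

lemma block_op_injective:
  assumes N: "0 < N" "N dvd M" and m: "0 \<le> m" and b: "0 < b" "b \<le> 1"
    and z: "\<And>x. x \<in> cube d M \<Longrightarrow> block_op d N M m b g x = 0" and x: "x \<in> cube d M"
  shows "g x = 0"
proof -
  \<comment> \<open>Small enough for both \<open>\<kappa> \<le> b\<close> and
    \<open>\<kappa> * d \<le> 2\<close>; the weight is trivial here.\<close>
  define \<kappa> where "\<kappa> = b / (real d + 1)"
  have \<kappa>: "\<kappa> \<le> b" "0 < \<kappa>" "\<kappa> * d \<le> 2"
  proof -
    show "0 < \<kappa>" using b by (simp add: \<kappa>_def add_nonneg_pos)
    have "b * 1 \<le> b * (real d + 1)" using b by (intro mult_left_mono) auto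
    then show "\<kappa> \<le> b" by (simp add: \<kappa>_def divide_le_eq)
    have "b * real d \<le> 1 * real d" using b by (intro mult_right_mono) auto
    then have "b * real d \<le> 2 * (real d + 1)" by simp
    then show "\<kappa> * d \<le> 2" by (simp add: \<kappa>_def divide_le_eq)
  qed
  have "(\<Sum>x\<in>cube d M. (exp 0 * g x)\<^sup>2) \<le> (2 / \<kappa>)\<^sup>2 * (\<Sum>x\<in>cube d M. (exp 0 * 0)\<^sup>2)"
    using weighted_l2_bound[OF N m b(2) \<kappa>, of 0 "\<lambda>_. 0" g "\<lambda>_. 0"] \<kappa> z by (simp add: fdiff_def)
  then have "(\<Sum>x\<in>cube d M. (g x)\<^sup>2) = 0" by (simp add: antisym sum_nonneg)
  then show ?thesis using x by (simp add: sum_nonneg_eq_0_iff)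
qed

lemma block_op_solvable:
  assumes "0 < N" "N dvd M" "0 \<le> m" "0 < b" "b \<le> 1"
  shows "\<exists>g. (\<forall>x. x \<notin> cube d M \<longrightarrow> g x = 0) \<and> (\<forall>x\<in>cube d M. block_op d N M m b g x = f x)"
proof (rule injective_imp_surjective_finite_support[OF finite_cube block_op_lincomb])
  fix g assume "\<And>x. x \<notin> cube d M \<Longrightarrow> g x = 0" "\<And>x. x \<in> cube d M \<Longrightarrow> block_op d N M m b g x = 0"
  with block_op_injective[OF assms, of d g] show "g = (\<lambda>x. 0)" by blast
qed

section \<open>The massive resolvent\<close>

text \<open>Without the average all off-diagonal entries are nonpositive, so the inverse preserves
  positivity. The extra 1 gives a spectral gap that does not rely on \<open>m\<close>.\<close>

abbreviation massive_op :: "nat \<Rightarrow> nat \<Rightarrow> nat \<Rightarrow> real \<Rightarrow> ((nat \<Rightarrow> nat) \<Rightarrow> real) \<Rightarrow> (nat \<Rightarrow> nat) \<Rightarrow> real"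
  where "massive_op d N M m \<equiv> block_op d N M (1 + m) 0"

lemma massive_op_eq: "massive_op d N M m g x = (real N)\<^sup>2 * (\<Sum>\<nu><d. nlap M \<nu> g x) + (1 + m) * g x"
  by (simp add: block_op_def)

lemma massive_op_selfadjoint:
  "(\<Sum>x\<in>cube d M. f x * massive_op d N M m g x) = (\<Sum>x\<in>cube d M. massive_op d N M m f x * g x)"
proof -
  have "(\<Sum>x\<in>cube d M. f x * (\<Sum>\<nu><d. nlap M \<nu> g x)) = (\<Sum>\<nu><d. \<Sum>x\<in>cube d M. f x * nlap M \<nu> g x)"
    unfolding sum_distrib_left by (rule sum.swap)
  also have "\<dots> = (\<Sum>\<nu><d. \<Sum>x\<in>cube d M. nlap M \<nu> f x * g x)"
    by (rule sum.cong[OF refl], rule sum_nlap_selfadjoint, rule line_closed_cube) simp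
  also have "\<dots> = (\<Sum>x\<in>cube d M. (\<Sum>\<nu><d. nlap M \<nu> f x) * g x)"
    unfolding sum_distrib_right by (rule sum.swap)
  finally have "(\<Sum>x\<in>cube d M. f x * (\<Sum>\<nu><d. nlap M \<nu> g x)) = (\<Sum>x\<in>cube d M. (\<Sum>\<nu><d. nlap M \<nu> f x) * g x)" .
  then have "(real N)\<^sup>2 * (\<Sum>x\<in>cube d M. f x * (\<Sum>\<nu><d. nlap M \<nu> g x))
      = (real N)\<^sup>2 * (\<Sum>x\<in>cube d M. (\<Sum>\<nu><d. nlap M \<nu> f x) * g x)" by simp
  then show ?thesis
    unfolding massive_op_eq by (simp add: algebra_simps sum.distrib sum_distrib_left)
qed

text \<open>At a minimum every \<open>nlap\<close> is nonpositive, also on the boundary, where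
  missing neighbours contribute 0. A negative minimum would then make the mass term
  negative.\<close>

lemma massive_op_min_principle:
  assumes m: "0 \<le> m" and pos: "\<And>x. x \<in> cube d M \<Longrightarrow> 0 \<le> massive_op d N M m v x"
    and x: "x \<in> cube d M"
  shows "0 \<le> v x"
proof (rule ccontr)
  assume neg: "\<not> 0 \<le> v x"
  obtain z where z: "z \<in> cube d M" "\<And>y. y \<in> cube d M \<Longrightarrow> v z \<le> v y"
    using ex_is_arg_min_if_finite[of "cube d M" v] x by (auto simp: is_arg_min_linorder)
  have "nlap M \<nu> v z \<le> 0" if "\<nu> < d" for \<nu>
  proof -
    have "v z \<le> v (z(\<nu> := Suc (z \<nu>)))" if "Suc (z \<nu>) < M"
      using z cube_upd[OF z(1) \<open>\<nu> < d\<close> that] by simp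
    moreover have "v z \<le> v (z(\<nu> := z \<nu> - 1))"
      using z cube_upd[OF z(1) that, of "z \<nu> - 1"] cube_less[OF z(1) that] by simp
    ultimately have "(if Suc (z \<nu>) < M then v z - v (z(\<nu> := Suc (z \<nu>))) else 0) \<le> 0"
      "(if 0 < z \<nu> then v z - v (z(\<nu> := z \<nu> - 1)) else 0) \<le> 0" by simp_all
    then show ?thesis unfolding nlap_def by linarith
  qed
  then have "(real N)\<^sup>2 * (\<Sum>\<nu><d. nlap M \<nu> v z) \<le> 0"
    by (intro mult_nonneg_nonpos sum_nonpos) auto
  moreover have "(1 + m) * v z < 0" using m neg z(2)[OF x] by (intro mult_pos_neg) auto
  ultimately show False using pos[OF z(1)] by (simp add: massive_op_eq)
qed

lemma massive_op_solvable:
  assumes "0 \<le> m"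
  shows "\<exists>g. (\<forall>x. x \<notin> cube d M \<longrightarrow> g x = 0) \<and> (\<forall>x\<in>cube d M. massive_op d N M m g x = f x)"
proof (rule injective_imp_surjective_finite_support[OF finite_cube block_op_lincomb])
  fix g assume supp: "\<And>x. x \<notin> cube d M \<Longrightarrow> g x = 0"
    and z: "\<And>x. x \<in> cube d M \<Longrightarrow> massive_op d N M m g x = 0"
  have T0: "massive_op d N M m (\<lambda>y. 0) x = 0" for x
    using block_op_lincomb[of d N M "1 + m" 0 1 "\<lambda>_. 0" "\<lambda>_. 0" x] by simp
  have "massive_op d N M m (\<lambda>y. - g y) x = 0" if "x \<in> cube d M" for x
    using block_op_lincomb[of d N M "1 + m" 0 "-1" g "\<lambda>_. 0" x] z[OF that] T0 by simp
  then have "0 \<le> g x" "0 \<le> - g x" if "x \<in> cube d M" for x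
    using massive_op_min_principle[OF assms, of d M N g x]
      massive_op_min_principle[OF assms, of d M N "\<lambda>y. - g y" x] z that by simp_all
  then show "g = (\<lambda>x. 0)" using supp by (metis neg_0_le_iff_le order_antisym)
qed

section \<open>Directional factors of the massive operator and the sup norm\<close>

lemma nlap_scale: "nlap M \<mu> (\<lambda>y. c * f y) x = c * nlap M \<mu> f x"
  by (simp add: nlap_def algebra_simps)

lemma nlap_add: "nlap M \<mu> (\<lambda>y. f y + g y) x = nlap M \<mu> f x + nlap M \<mu> g x"
  by (simp add: nlap_def)

lemma nlap_sum: "nlap M \<mu> (\<lambda>y. \<Sum>i\<in>I. f i y) x = (\<Sum>i\<in>I. nlap M \<mu> (f i) x)"
  by (simp add: nlap_def sum.distrib sum_subtractf)

text \<open>Split the massive operator into the factor for direction \<nu> and the rest. Their inner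
  product expands into nonnegative forms, since the directional operators are nonnegative and
  commute, so discarding the rest cannot increase the norm.\<close>

lemma l2_le_massive_op:
  assumes \<nu>: "\<nu> < d" and m: "0 \<le> m"
  shows "(\<Sum>x\<in>cube d M. (z x + (real N)\<^sup>2 * nlap M \<nu> z x)\<^sup>2) \<le> (\<Sum>x\<in>cube d M. (massive_op d N M m z x)\<^sup>2)"
proof -
  let ?B = "cube d M" and ?n = "(real N)\<^sup>2"
  define p where "p x = z x + ?n * nlap M \<nu> z x" for x
  define q where "q x = m * z x + ?n * (\<Sum>\<mu>\<in>{..<d} - {\<nu>}. nlap M \<mu> z x)" for x
  have lc: "line_closed M \<mu> ?B" if "\<mu> < d" for \<mu> using that by (rule line_closed_cube)
  have T: "massive_op d N M m z x = p x + q x" for x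
    using \<nu> by (simp add: massive_op_eq p_def q_def sum.remove[of "{..<d}" \<nu>] algebra_simps)
  have "p x * q x = m * (z x)\<^sup>2 + m * ?n * (z x * nlap M \<nu> z x)
      + ?n * (\<Sum>\<mu>\<in>{..<d} - {\<nu>}. z x * nlap M \<mu> z x)
      + ?n\<^sup>2 * (\<Sum>\<mu>\<in>{..<d} - {\<nu>}. nlap M \<nu> z x * nlap M \<mu> z x)" for x
    unfolding p_def q_def sum_distrib_left[symmetric] by (simp add: power2_eq_square algebra_simps)
  then have "(\<Sum>x\<in>?B. p x * q x) = m * (\<Sum>x\<in>?B. (z x)\<^sup>2) + m * ?n * (\<Sum>x\<in>?B. z x * nlap M \<nu> z x)
      + ?n * (\<Sum>\<mu>\<in>{..<d} - {\<nu>}. \<Sum>x\<in>?B. z x * nlap M \<mu> z x)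
      + ?n\<^sup>2 * (\<Sum>\<mu>\<in>{..<d} - {\<nu>}. \<Sum>x\<in>?B. nlap M \<nu> z x * nlap M \<mu> z x)"
    unfolding sum.swap[of "\<lambda>\<mu> x. z x * nlap M \<mu> z x" ?B "{..<d} - {\<nu>}"]
      sum.swap[of "\<lambda>\<mu> x. nlap M \<nu> z x * nlap M \<mu> z x" ?B "{..<d} - {\<nu>}"]
    by (simp only: sum.distrib sum_distrib_left[symmetric])
  also have "\<dots> \<ge> 0"
    using m \<nu> lc by (intro add_nonneg_nonneg mult_nonneg_nonneg sum_nonneg sum_nlap_nonneg sum_nlap_nlap_nonneg) auto
  finally have "0 \<le> (\<Sum>x\<in>?B. p x * q x)" .
  moreover have "(\<Sum>x\<in>?B. (p x + q x)\<^sup>2) = (\<Sum>x\<in>?B. (p x)\<^sup>2) + (\<Sum>x\<in>?B. (q x)\<^sup>2) + 2 * (\<Sum>x\<in>?B. p x * q x)"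
    by (simp add: power2_sum sum.distrib sum_distrib_left mult.assoc)
  moreover have "0 \<le> (\<Sum>x\<in>?B. (q x)\<^sup>2)" by (simp add: sum_nonneg)
  ultimately have "(\<Sum>x\<in>?B. (p x)\<^sup>2) \<le> (\<Sum>x\<in>?B. (p x + q x)\<^sup>2)" by linarith
  then show ?thesis unfolding T p_def by simp
qed

text \<open>The product of 1 minus the second difference over the first \<open>j\<close> directions,
  built up so that the Sobolev step can be iterated one direction at a time.\<close>

primrec prod_op :: "nat \<Rightarrow> nat \<Rightarrow> nat \<Rightarrow> ((nat \<Rightarrow> nat) \<Rightarrow> real) \<Rightarrow> (nat \<Rightarrow> nat) \<Rightarrow> real" where
  "prod_op N M 0 v = v"
| "prod_op N M (Suc j) v = (\<lambda>x. prod_op N M j v x + (real N)\<^sup>2 * nlap M j (prod_op N M j v) x)"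

text \<open>Needed because the resolvent identities are asserted only on the cube; under the Neumann
  condition no value outside it is read.\<close>

lemma prod_op_cong:
  assumes "\<And>x. x \<in> cube d M \<Longrightarrow> f x = g x" "j \<le> d"
  shows "x \<in> cube d M \<Longrightarrow> prod_op N M j f x = prod_op N M j g x"
  using assms(2)
proof (induction j arbitrary: x)
  case 0 then show ?case using assms(1) by simp
next
  case (Suc j)
  have "nlap M j (prod_op N M j f) x = nlap M j (prod_op N M j g) x"
    by (rule nlap_cong[OF line_closed_cube]) (use Suc in auto)
  then show ?case using Suc by simp
qed

lemma massive_op_commute:
  "massive_op d N M m (\<lambda>x. v x + (real N)\<^sup>2 * nlap M j v x) x
    = massive_op d N M m v x + (real N)\<^sup>2 * nlap M j (massive_op d N M m v) x"
proof -
  have "nlap M \<nu> (nlap M j v) x = nlap M j (nlap M \<nu> v) x" for \<nu>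
    by (cases "\<nu> = j") (auto simp: nlap_commute)
  then have "(\<Sum>\<nu><d. nlap M \<nu> (nlap M j v) x) = nlap M j (\<lambda>y. \<Sum>\<nu><d. nlap M \<nu> v y) x"
    by (simp add: nlap_sum)
  moreover have "massive_op d N M m v = (\<lambda>y. (real N)\<^sup>2 * (\<Sum>\<nu><d. nlap M \<nu> v y) + (1 + m) * v y)"
    by (rule ext) (rule massive_op_eq)
  ultimately show ?thesis
    unfolding massive_op_eq
    by (simp only: nlap_add nlap_scale sum.distrib sum_distrib_left[symmetric]) (simp add: algebra_simps)
qed

lemma massive_op_prod_op: "massive_op d N M m (prod_op N M j v) = prod_op N M j (massive_op d N M m v)"
proof (induction j)
  case 0 show ?case by simp
next
  case (Suc j) show ?case by (rule ext) (simp add: massive_op_commute Suc.IH)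
qed

text \<open>One inverse of the massive operator pays for one directional factor. Commutation moves
  \<open>massive_op\<close> past the factors already present, where it lowers the index of
  \<open>z\<close>.\<close>

lemma prod_op_chain_bound:
  assumes m: "0 \<le> m" and chain: "\<And>i x. x \<in> cube d M \<Longrightarrow> massive_op d N M m (z (Suc i)) x = z i x"
    and "j \<le> d"
  shows "(\<Sum>x\<in>cube d M. (prod_op N M j (z (i + j)) x)\<^sup>2) \<le> (\<Sum>x\<in>cube d M. (z i x)\<^sup>2)"
  using \<open>j \<le> d\<close>
proof (induction j)
  case 0 show ?case by simp
next
  case (Suc j)
  have "(\<Sum>x\<in>cube d M. (prod_op N M (Suc j) (z (i + Suc j)) x)\<^sup>2)
      \<le> (\<Sum>x\<in>cube d M. (massive_op d N M m (prod_op N M j (z (Suc (i + j)))) x)\<^sup>2)"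
    using l2_le_massive_op[of j d m "prod_op N M j (z (Suc (i + j)))" N M] Suc.prems m
    by simp
  also have "\<dots> = (\<Sum>x\<in>cube d M. (prod_op N M j (z (i + j)) x)\<^sup>2)"
    unfolding massive_op_prod_op
  proof (rule sum.cong[OF refl])
    fix x assume x: "x \<in> cube d M"
    have "prod_op N M j (massive_op d N M m (z (Suc (i + j)))) x = prod_op N M j (z (i + j)) x"
      by (rule prod_op_cong[OF chain _ x]) (use Suc.prems in auto)
    then show "(prod_op N M j (massive_op d N M m (z (Suc (i + j)))) x)\<^sup>2 = (prod_op N M j (z (i + j)) x)\<^sup>2"
      by simp
  qed
  also have "\<dots> \<le> (\<Sum>x\<in>cube d M. (z i x)\<^sup>2)" using Suc by simp
  finally show ?case .
qed

text \<open>The slice leaves the first \<open>j\<close> coordinates free. The one-dimensional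
  inequality in direction \<open>j\<close> frees one more, at the price of \<open>2 / N\<close> and
  one directional factor.\<close>

lemma sobolev_slice:
  assumes N: "0 < N" "N dvd M" and x: "x \<in> cube d M" and "j \<le> d"
  shows "(v x)\<^sup>2 \<le> (2 / N) ^ j * (\<Sum>y\<in>{y \<in> cube d M. \<forall>\<mu>\<ge>j. y \<mu> = x \<mu>}. (prod_op N M j v y)\<^sup>2)"
  using \<open>j \<le> d\<close>
proof (induction j)
  case 0
  have "{y \<in> cube d M. \<forall>\<mu>\<ge>0. y \<mu> = x \<mu>} = {x}" using x by (auto simp: fun_eq_iff)
  then show ?case by simp
next
  case (Suc j)
  let ?S = "\<lambda>j. {y \<in> cube d M. \<forall>\<mu>\<ge>j. y \<mu> = x \<mu>}"
  have "(\<Sum>y\<in>?S j. (prod_op N M j v y)\<^sup>2)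
      \<le> (\<Sum>y\<in>?S j. 2 / N * (\<Sum>t<M. (prod_op N M (Suc j) v (y(j := t)))\<^sup>2))"
    using Suc.prems sobolev_line[OF N] by (intro sum_mono) (auto simp: cube_less)
  also have "\<dots> = 2 / N * (\<Sum>p\<in>?S j \<times> {..<M}. (prod_op N M (Suc j) v ((fst p)(j := snd p)))\<^sup>2)"
    by (simp add: sum_distrib_left sum.cartesian_product case_prod_unfold)
  also have "(\<Sum>p\<in>?S j \<times> {..<M}. (prod_op N M (Suc j) v ((fst p)(j := snd p)))\<^sup>2)
      = (\<Sum>y\<in>?S (Suc j). (prod_op N M (Suc j) v y)\<^sup>2)"
  proof (rule sum.reindex_bij_witness[of _ "\<lambda>y. (y(j := x j), y j)" "\<lambda>p. (fst p)(j := snd p)"])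
    have j: "j < d" using Suc.prems by simp
    fix p assume "p \<in> ?S j \<times> {..<M}"
    then obtain y t where p: "p = (y, t)" "y \<in> cube d M" "\<forall>\<mu>\<ge>j. y \<mu> = x \<mu>" "t < M" by auto
    show "(((fst p)(j := snd p))(j := x j), ((fst p)(j := snd p)) j) = p"
      using p by (simp add: fun_upd_idem)
    show "(fst p)(j := snd p) \<in> ?S (Suc j)" using p j by (simp add: cube_upd)
  next
    have j: "j < d" using Suc.prems by simp
    fix y assume y: "y \<in> ?S (Suc j)"
    show "(fst (y(j := x j), y j))(j := snd (y(j := x j), y j)) = y" by simp
    have "(y(j := x j)) \<mu> = x \<mu>" if "j \<le> \<mu>" for \<mu>
      using y that by (cases "\<mu> = j") simp_all
    then show "(y(j := x j), y j) \<in> ?S j \<times> {..<M}"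
      using y j cube_less[OF x j] cube_less[of y d M j] by (simp add: cube_upd)
  qed simp
  finally have "(2 / N) ^ j * (\<Sum>y\<in>?S j. (prod_op N M j v y)\<^sup>2)
      \<le> (2 / N) ^ j * (2 / N * (\<Sum>y\<in>?S (Suc j). (prod_op N M (Suc j) v y)\<^sup>2))"
    by (intro mult_left_mono) auto
  then show ?case using Suc by (simp add: mult_ac)
qed

lemma sobolev_cube:
  assumes "0 < N" "N dvd M" "x \<in> cube d M"
  shows "(v x)\<^sup>2 \<le> (2 / N) ^ d * (\<Sum>y\<in>cube d M. (prod_op N M d v y)\<^sup>2)"
proof -
  have "{y \<in> cube d M. \<forall>\<mu>\<ge>d. y \<mu> = x \<mu>} = cube d M"
    using assms by (auto simp: cube_def gbox_def)
  then show ?thesis using sobolev_slice[OF assms order_refl, of v] by simp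
qed

text \<open>\<open>K j\<close> is the column at \<open>x0\<close> of the \<open>j\<close>-th power of the inverse of \<open>massive_op\<close>, without the
 normalisation \<open>\<eta>\<^sup>-\<^sup>d\<close> of the delta function. Values outside the cube are irrelevant.\<close>

definition resolvent_chain :: "nat \<Rightarrow> nat \<Rightarrow> nat \<Rightarrow> real \<Rightarrow> (nat \<Rightarrow> nat) \<Rightarrow> (nat \<Rightarrow> (nat \<Rightarrow> nat) \<Rightarrow> real) \<Rightarrow> bool" where
  "resolvent_chain d N M m x0 K \<longleftrightarrow> (\<forall>x\<in>cube d M. K 0 x = (if x = x0 then 1 else 0))
     \<and> (\<forall>j. \<forall>x\<in>cube d M. massive_op d N M m (K (Suc j)) x = K j x)"

lemma resolvent_chain_exists:
  assumes "0 \<le> m" shows "\<exists>K. resolvent_chain d N M m x0 K"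
proof -
  obtain R where R: "\<And>f x. x \<in> cube d M \<Longrightarrow> massive_op d N M m (R f) x = f x"
    using massive_op_solvable[OF assms, of d M N] by metis
  define K where "K j = (R ^^ j) (\<lambda>x. if x = x0 then 1 else 0)" for j
  have "resolvent_chain d N M m x0 K" by (simp add: resolvent_chain_def K_def R)
  then show ?thesis by blast
qed

section \<open>Positivity, weighted mass and sup bound of the resolvent kernels\<close>

context
  fixes d N M :: nat and m :: real and x0 :: "nat \<Rightarrow> nat" and K
  assumes m: "0 \<le> m" and x0: "x0 \<in> cube d M" and K: "resolvent_chain d N M m x0 K"
begin

lemma chain_0: "(\<Sum>x\<in>cube d M. K 0 x * f x) = f x0"
proof -
  have "(\<Sum>x\<in>cube d M. K 0 x * f x) = (\<Sum>x\<in>cube d M. if x = x0 then f x0 else 0)"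
    using K by (intro sum.cong) (auto simp: resolvent_chain_def)
  then show ?thesis using x0 by simp
qed

lemma chain_Suc: "x \<in> cube d M \<Longrightarrow> massive_op d N M m (K (Suc j)) x = K j x"
  using K by (simp add: resolvent_chain_def)

lemma chain_nonneg: "x \<in> cube d M \<Longrightarrow> 0 \<le> K j x"
proof (induction j arbitrary: x)
  case 0 then show ?case using K by (simp add: resolvent_chain_def)
next
  case (Suc j) then show ?case
    using massive_op_min_principle[OF m, of d M N "K (Suc j)"] chain_Suc by simp
qed

lemma chain_shift:
  "(\<Sum>x\<in>cube d M. K j x * f x) = (\<Sum>x\<in>cube d M. K (Suc j) x * massive_op d N M m f x)"
  unfolding massive_op_selfadjoint by (intro sum.cong) (auto simp: chain_Suc)

text \<open>Powers of the symmetric inverse multiply, so the inner product of two columns at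
  \<open>x0\<close> is a diagonal entry of the power with summed exponent.\<close>

lemma chain_inner: "(\<Sum>x\<in>cube d M. K i x * K j x) = K (i + j) x0"
proof (induction i arbitrary: j)
  case 0 then show ?case by (simp add: chain_0)
next
  case (Suc i)
  have "(\<Sum>x\<in>cube d M. K (Suc i) x * K j x)
      = (\<Sum>x\<in>cube d M. K (Suc i) x * massive_op d N M m (K (Suc j)) x)"
    by (intro sum.cong) (auto simp: chain_Suc)
  then show ?case using Suc.IH[of "Suc j"] chain_shift[of i "K (Suc j)"] by simp
qed

text \<open>Of the \<open>2 * d\<close> powers, \<open>d\<close> pay for the Sobolev inequality; the
  remaining squared norm is the diagonal value \<open>?s\<close>. At \<open>x0\<close> this reads
  \<open>?s\<^sup>2 \<le> (2 / N) ^ d * ?s\<close>, which bounds \<open>?s\<close> itself and then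
  every other value. Using only \<open>d\<close> powers would yield just the square root of this
  bound.\<close>

lemma chain_sup_bound:
  assumes N: "0 < N" "N dvd M" and y: "y \<in> cube d M"
  shows "K (2 * d) y \<le> (2 / N) ^ d"
proof -
  let ?s = "K (2 * d) x0"
  have sq: "(K (2 * d) x)\<^sup>2 \<le> (2 / N) ^ d * ?s" if "x \<in> cube d M" for x
  proof -
    have "(K (2 * d) x)\<^sup>2 \<le> (2 / N) ^ d * (\<Sum>y\<in>cube d M. (prod_op N M d (K (d + d)) y)\<^sup>2)"
      using sobolev_cube[OF N that, of "K (2 * d)"] by (simp add: mult_2)
    also have "\<dots> \<le> (2 / N) ^ d * (\<Sum>y\<in>cube d M. (K d y)\<^sup>2)"
      by (intro mult_left_mono prod_op_chain_bound[OF m]) (auto simp: chain_Suc)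
    also have "(\<Sum>y\<in>cube d M. (K d y)\<^sup>2) = ?s"
      using chain_inner[of d d] by (simp add: power2_eq_square mult_2)
    finally show ?thesis .
  qed
  have s0: "0 \<le> ?s" by (rule chain_nonneg[OF x0])
  have "?s \<le> (2 / N) ^ d"
  proof (cases "?s = 0")
    case True then show ?thesis by simp
  next
    case False
    then show ?thesis using sq[OF x0] s0 by (simp add: power2_eq_square)
  qed
  then have "(2 / N) ^ d * ?s \<le> ((2 / N) ^ d)\<^sup>2"
    unfolding power2_eq_square by (intro mult_left_mono) auto
  with sq[OF y] have "(K (2 * d) y)\<^sup>2 \<le> ((2 / N) ^ d)\<^sup>2" by linarith
  then show ?thesis by (rule power2_le_imp_le) simp
qed

text \<open>The unit mass splits off at each step: \<open>massive_op g\<close> is \<open>g\<close>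
  plus the source, and the remaining \<open>g\<close> is fed back into the next power.\<close>

lemma chain_representation:
  "g x0 = (\<Sum>j<n. \<Sum>x\<in>cube d M. K (Suc j) x * (massive_op d N M m g x - g x))
     + (\<Sum>x\<in>cube d M. K n x * g x)"
proof (induction n)
  case 0 show ?case by (simp add: chain_0)
next
  case (Suc n)
  have "(\<Sum>x\<in>cube d M. K n x * g x) = (\<Sum>x\<in>cube d M. K (Suc n) x * (massive_op d N M m g x - g x))
      + (\<Sum>x\<in>cube d M. K (Suc n) x * g x)"
    unfolding chain_shift[of n g] by (simp add: right_diff_distrib sum_subtractf)
  then show ?case using Suc.IH by simp
qed

text \<open>By positivity, each inverse of the massive operator at most doubles a weight satisfying
  the stated inequality.\<close>

lemma chain_weight:
  assumes "\<And>x. x \<in> cube d M \<Longrightarrow> W x \<le> 2 * massive_op d N M m W x" "W x0 = 1"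
  shows "(\<Sum>x\<in>cube d M. K j x * W x) \<le> 2 ^ j"
proof (induction j)
  case 0 show ?case by (simp add: chain_0 assms)
next
  case (Suc j)
  have "(\<Sum>x\<in>cube d M. K (Suc j) x * W x) \<le> (\<Sum>x\<in>cube d M. K (Suc j) x * (2 * massive_op d N M m W x))"
    using assms chain_nonneg by (intro sum_mono mult_left_mono) auto
  also have "\<dots> = 2 * (\<Sum>x\<in>cube d M. K j x * W x)"
    unfolding chain_shift[of j W] by (simp add: sum_distrib_left mult_ac)
  finally show ?case using Suc by simp
qed

lemma chain_pointwise_bound:
  assumes N: "0 < N" "N dvd M"
    and W: "\<And>x. x \<in> cube d M \<Longrightarrow> W x \<le> 2 * massive_op d N M m W x" "W x0 = 1"
      "\<And>x. x \<in> cube d M \<Longrightarrow> 0 < W x"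
    and H: "\<And>x. x \<in> cube d M \<Longrightarrow> \<bar>massive_op d N M m g x - g x\<bar> \<le> H * W x" "0 \<le> H"
  shows "\<bar>g x0\<bar> \<le> 2 ^ (2 * d + 1) * H + sqrt (2 ^ (2 * d) * (2 / N) ^ d * (\<Sum>x\<in>cube d M. (g x)\<^sup>2 / W x))"
proof -
  let ?B = "cube d M" and ?n = "2 * d"
  have "\<bar>\<Sum>x\<in>?B. K (Suc j) x * (massive_op d N M m g x - g x)\<bar> \<le> H * 2 ^ Suc j" for j
  proof -
    have "\<bar>\<Sum>x\<in>?B. K (Suc j) x * (massive_op d N M m g x - g x)\<bar> \<le> (\<Sum>x\<in>?B. K (Suc j) x * (H * W x))"
      using chain_nonneg H by (intro order_trans[OF sum_abs sum_mono]) (auto simp: abs_mult intro!: mult_mono)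
    also have "\<dots> = H * (\<Sum>x\<in>?B. K (Suc j) x * W x)" by (simp add: sum_distrib_left mult_ac)
    also have "\<dots> \<le> H * 2 ^ Suc j" using chain_weight[OF W(1,2)] H(2) by (intro mult_left_mono)
    finally show ?thesis .
  qed
  then have "\<bar>\<Sum>j<?n. \<Sum>x\<in>?B. K (Suc j) x * (massive_op d N M m g x - g x)\<bar> \<le> (\<Sum>j<?n. H * 2 ^ Suc j)"
    by (rule order_trans[OF sum_abs sum_mono])
  also have "\<dots> = 2 * H * (\<Sum>j<?n. 2 ^ j)" by (simp add: sum_distrib_left mult_ac)
  also have "\<dots> = 2 * H * (2 ^ ?n - 1)" by (simp add: geometric_sum)
  also have "\<dots> \<le> 2 ^ (?n + 1) * H" using H(2) by (simp add: algebra_simps)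
  finally have 1: "\<bar>\<Sum>j<?n. \<Sum>x\<in>?B. K (Suc j) x * (massive_op d N M m g x - g x)\<bar> \<le> 2 ^ (?n + 1) * H" .
  \<comment> \<open>Cauchy-Schwarz with \<open>sqrt (W x)\<close> shared out: of the two kernels
    produced, one is bounded in sup norm and the other is summed against \<open>W\<close>.\<close>
  have "(\<Sum>x\<in>?B. K ?n x * g x)\<^sup>2 = (\<Sum>x\<in>?B. (K ?n x * sqrt (W x)) * (g x / sqrt (W x)))\<^sup>2"
    using W(3) by (intro arg_cong[of _ _ "\<lambda>t. t\<^sup>2"] sum.cong) (auto simp: less_imp_neq[symmetric])
  also have "\<dots> \<le> (\<Sum>x\<in>?B. (K ?n x * sqrt (W x))\<^sup>2) * (\<Sum>x\<in>?B. (g x / sqrt (W x))\<^sup>2)"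
    by (rule Cauchy_Schwarz_ineq_sum)
  also have "\<dots> = (\<Sum>x\<in>?B. K ?n x * (K ?n x * W x)) * (\<Sum>x\<in>?B. (g x)\<^sup>2 / W x)"
    using W(3) by (intro arg_cong2[of _ _ _ _ "(*)"] sum.cong)
      (auto simp: power_mult_distrib power_divide less_imp_le power2_eq_square)
  also have "\<dots> \<le> ((2 / N) ^ d * 2 ^ ?n) * (\<Sum>x\<in>?B. (g x)\<^sup>2 / W x)"
  proof (intro mult_right_mono)
    have "(\<Sum>x\<in>?B. K ?n x * (K ?n x * W x)) \<le> (\<Sum>x\<in>?B. (2 / N) ^ d * (K ?n x * W x))"
      using chain_sup_bound[OF N] chain_nonneg W(3)
      by (intro sum_mono mult_right_mono) (auto intro!: mult_nonneg_nonneg simp: less_imp_le)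
    also have "\<dots> \<le> (2 / N) ^ d * 2 ^ ?n"
      unfolding sum_distrib_left[symmetric] using chain_weight[OF W(1,2)] by (intro mult_left_mono) auto
    finally show "(\<Sum>x\<in>?B. K ?n x * (K ?n x * W x)) \<le> (2 / N) ^ d * 2 ^ ?n" .
    show "0 \<le> (\<Sum>x\<in>?B. (g x)\<^sup>2 / W x)" using W(3) by (auto intro!: sum_nonneg simp: less_imp_le)
  qed
  finally have 2: "\<bar>\<Sum>x\<in>?B. K ?n x * g x\<bar> \<le> sqrt (2 ^ ?n * (2 / N) ^ d * (\<Sum>x\<in>?B. (g x)\<^sup>2 / W x))"
    by (intro real_le_rsqrt) (simp add: mult_ac)
  show ?thesis using 1 2 chain_representation[of g ?n] by linarith
qed

end

section \<open>Exponential weights\<close>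

lemma sum_power_le:
  fixes r :: real
  assumes "0 \<le> r" "r < 1"
  shows "(\<Sum>i<n. r ^ i) \<le> 1 / (1 - r)"
proof -
  have "(\<Sum>i<n. r ^ i) = (1 - r ^ n) / (1 - r)"
    using assms by (simp add: sum_gp_strict)
  also have "\<dots> \<le> 1 / (1 - r)" using assms by (intro divide_right_mono) auto
  finally show ?thesis .
qed

lemma sum_exp_abs_le:
  assumes "0 < \<delta>" "0 < N" "t0 < M"
  shows "(\<Sum>t<M. exp (- \<delta> * (\<bar>real t - real t0\<bar> / real N))) \<le> real N * (2 * (1 + 1 / \<delta>))"
proof -
  define s where "s = \<delta> / N"
  define r where "r = exp (- s)"
  have s: "0 < s" using assms by (simp add: s_def)
  then have r: "0 \<le> r" "r < 1" by (simp_all add: r_def)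
  have pow: "exp (- \<delta> * (\<bar>real t - real t0\<bar> / real N)) = r ^ (if t < t0 then t0 - t else t - t0)" for t
  proof -
    have "r ^ k = exp (- \<delta> * (real k / real N))" for k
      unfolding r_def exp_of_nat_mult[symmetric] s_def by simp
    then show ?thesis by (simp add: of_nat_diff)
  qed
  have split: "{..<M} = {..<t0} \<union> {t0..<M}" using assms by auto
  have "(\<Sum>t<M. exp (- \<delta> * (\<bar>real t - real t0\<bar> / real N)))
      = (\<Sum>t<t0. r ^ (t0 - t)) + (\<Sum>t\<in>{t0..<M}. r ^ (t - t0))"
    unfolding pow split by (subst sum.union_disjoint) auto
  also have "(\<Sum>t<t0. r ^ (t0 - t)) = (\<Sum>i<t0. r ^ (t0 - (t0 - Suc i)))"
    by (rule sum.nat_diff_reindex[symmetric])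
  also have "\<dots> \<le> (\<Sum>i<t0. r ^ i)"
  proof (rule sum_mono)
    fix i assume "i \<in> {..<t0}"
    then have "t0 - (t0 - Suc i) = Suc i" by simp
    then show "r ^ (t0 - (t0 - Suc i)) \<le> r ^ i" using r by (simp add: mult_left_le_one_le)
  qed
  also have "(\<Sum>i<t0. r ^ i) \<le> 1 / (1 - r)" using r by (rule sum_power_le)
  also have "(\<Sum>t\<in>{t0..<M}. r ^ (t - t0)) = (\<Sum>i<M - t0. r ^ i)"
    by (simp add: sum.atLeastLessThan_shift_0[of _ t0] atLeast0LessThan)
  also have "\<dots> \<le> 1 / (1 - r)" using r by (rule sum_power_le)
  finally have "(\<Sum>t<M. exp (- \<delta> * (\<bar>real t - real t0\<bar> / real N))) \<le> 2 * (1 / (1 - r))" by simp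
  \<comment> \<open>The geometric series has ratio \<open>exp (- \<delta> / N)\<close>, so its sum
    grows only like \<open>N / \<delta>\<close>, as for a Riemann sum.\<close>
  also have "1 / (1 - r) \<le> 1 + 1 / s"
  proof -
    have "1 + s \<le> exp s" using exp_ge_add_one_self[of s] by simp
    then have "r * (1 + s) \<le> r * exp s" using r by (intro mult_left_mono)
    then have "r * (1 + s) \<le> 1" by (simp add: r_def exp_minus)
    then have "s \<le> (1 + s) * (1 - r)" by (simp add: algebra_simps)
    then have "1 \<le> (1 + s) / s * (1 - r)" using s by (simp add: le_divide_eq)
    then have "1 / (1 - r) \<le> (1 + s) / s" using r by (simp add: divide_le_eq)
    then show ?thesis using s by (simp add: add_divide_distrib)
  qed
  also have "1 + 1 / s \<le> real N * (1 + 1 / \<delta>)"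
    using assms by (simp add: s_def distrib_left)
  finally show ?thesis by (simp add: mult_ac)
qed

text \<open>The l1 distance in physical units. Its exponentials factor over coordinates, and its
  unit steps and cell diameters give exactly the two variation bounds asked for by the energy
  estimate.\<close>

definition rdist :: "nat \<Rightarrow> nat \<Rightarrow> (nat \<Rightarrow> nat) \<Rightarrow> (nat \<Rightarrow> nat) \<Rightarrow> real" where
  "rdist d N x0 x = (\<Sum>\<mu><d. \<bar>real (x \<mu>) - real (x0 \<mu>)\<bar> / real N)"

lemma rdist_nonneg: "0 \<le> rdist d N x0 x"
  by (simp add: rdist_def sum_nonneg)

lemma fdiff_rdist_le:
  assumes "\<nu> < d"
  shows "\<bar>fdiff \<nu> (rdist d N x0) x\<bar> \<le> 1 / N"
proof -
  have "fdiff \<nu> (rdist d N x0) x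
      = (\<bar>real (Suc (x \<nu>)) - real (x0 \<nu>)\<bar> - \<bar>real (x \<nu>) - real (x0 \<nu>)\<bar>) / N"
    using assms
    by (simp add: fdiff_def rdist_def sum.remove[of "{..<d}" \<nu>] diff_divide_distrib)
  also have "\<bar>\<dots>\<bar> \<le> 1 / N"
    unfolding abs_divide by (simp add: divide_right_mono)
  finally show ?thesis .
qed

lemma rdist_cell_le:
  assumes "0 < N" "y \<in> cell d N M x"
  shows "\<bar>rdist d N x0 x - rdist d N x0 y\<bar> \<le> d"
proof -
  have "\<bar>rdist d N x0 x - rdist d N x0 y\<bar>
      \<le> (\<Sum>\<mu><d. \<bar>\<bar>real (x \<mu>) - real (x0 \<mu>)\<bar> / N - \<bar>real (y \<mu>) - real (x0 \<mu>)\<bar> / N\<bar>)"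
    unfolding rdist_def sum_subtractf[symmetric] by (rule sum_abs)
  also have "\<dots> \<le> (\<Sum>\<mu><d. 1)"
  proof (rule sum_mono)
    fix \<mu> assume "\<mu> \<in> {..<d}"
    then have "y \<mu> div N = x \<mu> div N" using assms by (simp add: cell_def)
    then have "x \<mu> \<in> {x \<mu> div N * N..<x \<mu> div N * N + N}" "y \<mu> \<in> {x \<mu> div N * N..<x \<mu> div N * N + N}"
      unfolding block_eq_interval[OF assms(1), symmetric] by auto
    then have "x \<mu> \<le> y \<mu> + N" "y \<mu> \<le> x \<mu> + N"
      unfolding atLeastLessThan_iff by linarith+
    then have "\<bar>\<bar>real (x \<mu>) - real (x0 \<mu>)\<bar> - \<bar>real (y \<mu>) - real (x0 \<mu>)\<bar>\<bar> \<le> real N" by linarith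
    then show "\<bar>\<bar>real (x \<mu>) - real (x0 \<mu>)\<bar> / N - \<bar>real (y \<mu>) - real (x0 \<mu>)\<bar> / N\<bar> \<le> 1"
      unfolding diff_divide_distrib[symmetric] abs_divide using assms by simp
  qed
  finally show ?thesis by simp
qed

lemma sum_exp_rdist_le:
  assumes "0 < \<delta>" "0 < N" "x0 \<in> cube d M"
  shows "(\<Sum>x\<in>cube d M. exp (- \<delta> * rdist d N x0 x)) \<le> real N ^ d * (2 * (1 + 1 / \<delta>)) ^ d"
proof -
  have "(\<Sum>x\<in>cube d M. exp (- \<delta> * rdist d N x0 x))
      = (\<Sum>x\<in>cube d M. \<Prod>\<mu><d. exp (- \<delta> * (\<bar>real (x \<mu>) - real (x0 \<mu>)\<bar> / N)))"
    by (simp add: rdist_def sum_distrib_left exp_sum)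
  also have "\<dots> = (\<Prod>\<mu><d. \<Sum>t<M. exp (- \<delta> * (\<bar>real t - real (x0 \<mu>)\<bar> / N)))"
    unfolding cube_def by (rule sum_prod_gbox)
  also have "\<dots> \<le> (\<Prod>\<mu><d. real N * (2 * (1 + 1 / \<delta>)))"
    using assms cube_less by (intro prod_mono conjI sum_exp_abs_le sum_nonneg) auto
  finally show ?thesis by (simp add: power_mult_distrib)
qed

text \<open>A replacement for \<open>exp (s * \<bar>t\<bar>)\<close> in each coordinate without the
  kink at \<open>x0\<close>: at the kink the scaled second difference would be of order
  \<open>N\<close>, whereas cosh is an eigenfunction of the second difference with eigenvalue of
  order \<open>s\<^sup>2\<close>.\<close>

definition cosh_weight :: "nat \<Rightarrow> real \<Rightarrow> (nat \<Rightarrow> nat) \<Rightarrow> (nat \<Rightarrow> nat) \<Rightarrow> real" where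
  "cosh_weight d s x0 x = (\<Prod>\<mu><d. cosh (s * (real (x \<mu>) - real (x0 \<mu>))))"

lemma cosh_weight_pos: "0 < cosh_weight d s x0 x"
  by (simp add: cosh_weight_def prod_pos)

lemma cosh_weight_self: "cosh_weight d s x x = 1"
  by (simp add: cosh_weight_def)

lemma cosh_weight_ge:
  assumes "0 < N" "0 \<le> \<theta>"
  shows "exp (\<theta> * rdist d N x0 x) \<le> 2 ^ d * cosh_weight d (\<theta> / N) x0 x"
proof -
  have "exp (\<theta> * rdist d N x0 x) = (\<Prod>\<mu><d. exp (\<theta> * (\<bar>real (x \<mu>) - real (x0 \<mu>)\<bar> / N)))"
    by (simp add: rdist_def sum_distrib_left exp_sum)
  also have "\<dots> \<le> (\<Prod>\<mu><d. 2 * cosh (\<theta> / N * (real (x \<mu>) - real (x0 \<mu>))))"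
  proof (intro prod_mono conjI)
    fix \<mu>
    have *: "exp \<bar>t\<bar> \<le> 2 * cosh t" for t :: real by (simp add: cosh_def abs_if)
    have eq: "\<bar>\<theta> / N * (real (x \<mu>) - real (x0 \<mu>))\<bar> = \<theta> * (\<bar>real (x \<mu>) - real (x0 \<mu>)\<bar> / N)"
      using assms by (simp add: abs_mult)
    show "exp (\<theta> * (\<bar>real (x \<mu>) - real (x0 \<mu>)\<bar> / N)) \<le> 2 * cosh (\<theta> / N * (real (x \<mu>) - real (x0 \<mu>)))"
      using *[of "\<theta> / N * (real (x \<mu>) - real (x0 \<mu>))"] unfolding eq .
  qed simp
  finally show ?thesis by (simp add: cosh_weight_def prod.distrib)
qed

text \<open>At sites with both neighbours the addition formula gives equality. At a face the missing
  neighbour lies on the side away from \<open>x0\<close>, where cosh is larger, so the omitted term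
  is nonpositive and omitting it helps.\<close>

lemma nlap_cosh_weight_ge:
  assumes \<nu>: "\<nu> < d" and x: "x \<in> cube d M" and x0: "x0 \<in> cube d M" and s: "0 \<le> s"
  shows "- (2 * cosh s - 2) * cosh_weight d s x0 x \<le> nlap M \<nu> (cosh_weight d s x0) x"
proof -
  define c where "c = (\<Prod>\<mu>\<in>{..<d} - {\<nu>}. cosh (s * (real (x \<mu>) - real (x0 \<mu>))))"
  define u where "u = real (x \<nu>) - real (x0 \<nu>)"
  have c: "0 \<le> c" by (simp add: c_def prod_nonneg)
  have W: "cosh_weight d s x0 (x(\<nu> := t)) = c * cosh (s * (real t - real (x0 \<nu>)))" for t
    using \<nu> by (simp add: cosh_weight_def c_def prod.remove[of "{..<d}" \<nu>])
  have Wx: "cosh_weight d s x0 x = c * cosh (s * u)"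
    using W[of "x \<nu>"] by (simp add: u_def)
  have mono: "cosh (s * p) \<le> cosh (s * q)" if "\<bar>p\<bar> \<le> \<bar>q\<bar>" for p q
  proof -
    have "\<bar>s * p\<bar> \<le> \<bar>s * q\<bar>" using that s by (simp add: abs_mult mult_left_mono)
    then have "cosh \<bar>s * p\<bar> \<le> cosh \<bar>s * q\<bar>" by (subst cosh_real_nonneg_le_iff) auto
    then show ?thesis by (simp add: abs_if split: if_splits)
  qed
  have lt: "x \<nu> < M" "x0 \<nu> < M" using cube_less[OF x \<nu>] cube_less[OF x0 \<nu>] by auto
  have up: "c * (cosh (s * u) - cosh (s * (u + 1)))
      \<le> (if Suc (x \<nu>) < M then cosh_weight d s x0 x - cosh_weight d s x0 (x(\<nu> := Suc (x \<nu>))) else 0)"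
  proof (cases "Suc (x \<nu>) < M")
    case True then show ?thesis unfolding W Wx by (simp add: u_def algebra_simps)
  next
    case False
    then have "0 \<le> u" using lt by (simp add: u_def)
    then show ?thesis using False mono[of u "u + 1"] c by (simp add: mult_nonneg_nonpos)
  qed
  have dn: "c * (cosh (s * u) - cosh (s * (u - 1)))
      \<le> (if 0 < x \<nu> then cosh_weight d s x0 x - cosh_weight d s x0 (x(\<nu> := x \<nu> - 1)) else 0)"
  proof (cases "0 < x \<nu>")
    case True then show ?thesis unfolding W Wx by (simp add: u_def of_nat_diff algebra_simps)
  next
    case False
    then have "u \<le> 0" by (simp add: u_def)
    then show ?thesis using False mono[of u "u - 1"] c by (simp add: mult_nonneg_nonpos)
  qed
  have sum2: "cosh (s * (u + 1)) + cosh (s * (u - 1)) = 2 * cosh s * cosh (s * u)"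
    by (simp add: distrib_left right_diff_distrib cosh_add cosh_diff)
  have "c * (cosh (s * u) - cosh (s * (u + 1))) + c * (cosh (s * u) - cosh (s * (u - 1)))
      = 2 * (c * cosh (s * u)) - c * (cosh (s * (u + 1)) + cosh (s * (u - 1)))"
    by (simp add: right_diff_distrib distrib_left)
  also have "\<dots> = - (2 * cosh s - 2) * (c * cosh (s * u))"
    unfolding sum2 by (simp add: left_diff_distrib)
  finally have "- (2 * cosh s - 2) * (c * cosh (s * u))
      = c * (cosh (s * u) - cosh (s * (u + 1))) + c * (cosh (s * u) - cosh (s * (u - 1)))" ..
  then show ?thesis using up dn unfolding nlap_def Wx by linarith
qed

text \<open>With slope \<open>\<theta> / N\<close> the scaled Laplacian costs at most
  \<open>2 * d * \<theta>\<^sup>2\<close> times the weight, which the condition on \<theta> keeps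
  below half of the unit mass.\<close>

lemma cosh_weight_supersolution:
  assumes N: "0 < N" and m: "0 \<le> m" and \<theta>: "0 \<le> \<theta>" "\<theta> \<le> 1" "4 * real d * \<theta>\<^sup>2 \<le> 1"
    and x: "x \<in> cube d M" and x0: "x0 \<in> cube d M"
  shows "cosh_weight d (\<theta> / N) x0 x \<le> 2 * massive_op d N M m (cosh_weight d (\<theta> / N) x0) x"
proof -
  define s where "s = \<theta> / N"
  let ?W = "cosh_weight d s x0"
  have W: "0 < ?W x" by (rule cosh_weight_pos)
  have "\<theta> / N \<le> \<theta> / 1" using N \<theta> by (intro divide_left_mono) auto
  then have s: "0 \<le> s" "s \<le> 1" using \<theta> by (auto simp: s_def)
  have "2 * cosh s = exp s + exp (- s)" by (simp add: cosh_def field_simps)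
  then have "2 * cosh s - 2 \<le> 2 * s\<^sup>2"
    using exp_add_exp_minus_le[of s] s by simp
  then have "- (2 * s\<^sup>2) * ?W x \<le> - (2 * cosh s - 2) * ?W x"
    using W by (intro mult_right_mono) auto
  then have "- (2 * s\<^sup>2) * ?W x \<le> nlap M \<nu> ?W x" if "\<nu> < d" for \<nu>
    using nlap_cosh_weight_ge[OF that x x0 s(1)] by linarith
  then have "(\<Sum>\<nu><d. - (2 * s\<^sup>2) * ?W x) \<le> (\<Sum>\<nu><d. nlap M \<nu> ?W x)" by (intro sum_mono) auto
  then have le: "(real N)\<^sup>2 * (d * (- (2 * s\<^sup>2) * ?W x)) \<le> (real N)\<^sup>2 * (\<Sum>\<nu><d. nlap M \<nu> ?W x)"
    by (intro mult_left_mono) auto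
  have "(real N)\<^sup>2 * s\<^sup>2 = \<theta>\<^sup>2" using N by (simp add: s_def power_divide)
  then have "- (2 * real d * \<theta>\<^sup>2 * w) = (real N)\<^sup>2 * (d * (- (2 * s\<^sup>2) * w))" for w
    unfolding \<open>_ = \<theta>\<^sup>2\<close>[symmetric] by (simp add: mult_ac)
  then have "- (2 * real d * \<theta>\<^sup>2 * ?W x) \<le> (real N)\<^sup>2 * (\<Sum>\<nu><d. nlap M \<nu> ?W x)"
    using le by (simp only:)
  moreover have "2 * (2 * real d * \<theta>\<^sup>2 * ?W x) \<le> ?W x"
    using mult_right_mono[OF \<theta>(3), of "?W x"] W by simp
  moreover have "0 \<le> m * ?W x" using m W by simp
  moreover have "w \<le> 2 * (S + (1 * w + q))" if "- p \<le> S" "2 * p \<le> w" "0 \<le> q" for S p q w :: real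
    using that by (simp add: algebra_simps)
  ultimately show ?thesis
    unfolding s_def[symmetric] massive_op_eq distrib_right by blast
qed

section \<open>The pointwise bound for real functions\<close>

lemma avg_sq_le:
  assumes "0 < N" "N dvd M" "x \<in> cube d M"
  shows "(avg d N M g x)\<^sup>2 \<le> (\<Sum>y\<in>cell d N M x. (g y)\<^sup>2) / real N ^ d"
proof -
  have "(\<Sum>y\<in>cell d N M x. g y)\<^sup>2 \<le> (\<Sum>y\<in>cell d N M x. (g y)\<^sup>2) * card (cell d N M x)"
    by (rule sum_squared_le_sum_of_squares)
  then have "(\<Sum>y\<in>cell d N M x. g y)\<^sup>2 / (real N ^ d)\<^sup>2 \<le> (\<Sum>y\<in>cell d N M x. (g y)\<^sup>2) * real N ^ d / (real N ^ d)\<^sup>2"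
    using card_cell[OF assms] by (intro divide_right_mono) auto
  then show ?thesis using assms by (simp add: avg_def power_divide power2_eq_square)
qed

section \<open>Constants and the assembly of the estimates\<close>

definition decay_rate :: "nat \<Rightarrow> real \<Rightarrow> real" where
  "decay_rate d a = a / (4 * (real d)\<^sup>2)"

text \<open>Here \<open>4 * d / a\<close> is \<open>2 / \<kappa>\<close> for
  \<open>\<kappa> = a / (2 * d)\<close>, and the root comes from the lattice sum of the exponential
  weight after removing \<open>N ^ d\<close>.\<close>

definition l2_const :: "nat \<Rightarrow> real \<Rightarrow> real" where
  "l2_const d a = 4 * real d / a * sqrt ((2 * (1 + 1 / decay_rate d a)) ^ d)"

text \<open>The first summand bounds the geometric series of kernels on the source:
  \<open>2 ^ d\<close> is the cost of cosh and \<open>exp 1\<close> the variation of the weight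
  within a cell. The second is the remainder, with 16 = 4 * 2 * 2 from the kernel mass, the Sobolev
  constant and cosh.\<close>

definition sup_const :: "nat \<Rightarrow> real \<Rightarrow> real" where
  "sup_const d a = 2 ^ (2 * d + 1) * (2 ^ d * (1 + exp 1 * l2_const d a)) + sqrt (16 ^ d) * l2_const d a"

text \<open>After positivity, the items bound the rate of the cosh weight, the variation of the
  exponent over a cell, the loss in the supersolution inequality at twice the rate, and the
  conjugation error for \<open>\<kappa> = a / (2 * d)\<close>.\<close>

lemma decay_rate_bounds:
  assumes d: "1 \<le> d" and a: "0 < a" "a \<le> 1"
  shows "0 < decay_rate d a" "2 * decay_rate d a \<le> 1" "decay_rate d a * d \<le> 1"
    "4 * real d * (2 * decay_rate d a)\<^sup>2 \<le> 1"
    "(2 * real d + (real d)\<^sup>2) * (decay_rate d a)\<^sup>2 \<le> a / (2 * real d) / 2"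
proof -
  define D where "D = real d"
  have D: "1 \<le> D" using d by (simp add: D_def)
  have r: "decay_rate d a = a / (4 * D\<^sup>2)" by (simp add: decay_rate_def D_def)
  have D2: "D \<le> D\<^sup>2" "1 \<le> D\<^sup>2" using D by (simp_all add: power2_eq_square mult_le_cancel_left1 mult_ge1_I)
  have D3: "1 \<le> D ^ 3" using D by simp
  have a2: "a\<^sup>2 \<le> a" "a\<^sup>2 \<le> 1" using a by (simp_all add: power2_eq_square mult_left_le mult_le_one)
  show "0 < decay_rate d a" using a D by (simp add: r)
  show "2 * decay_rate d a \<le> 1" unfolding r using a D2 by (simp add: divide_le_eq)
  have "a * D \<le> 1 * D" using a D by (intro mult_right_mono) auto
  then have "a * D \<le> 4 * D\<^sup>2" using D2 D by linarith
  then show "decay_rate d a * d \<le> 1"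
    unfolding r D_def[symmetric] using D by (simp add: field_simps)
  have "4 * D * (2 * (a / (4 * D\<^sup>2)))\<^sup>2 = a\<^sup>2 / D ^ 3"
    using D by (simp add: field_simps power2_eq_square power3_eq_cube)
  also have "\<dots> \<le> 1" using D D3 a2 order_trans[OF a2(2) D3] by (intro divide_le_eq_1_pos[THEN iffD2]) auto
  finally show "4 * real d * (2 * decay_rate d a)\<^sup>2 \<le> 1" unfolding r D_def[symmetric] .
  have "(2 * D + D\<^sup>2) * (a / (4 * D\<^sup>2))\<^sup>2 \<le> (3 * D\<^sup>2) * (a / (4 * D\<^sup>2))\<^sup>2"
    using D2 by (intro mult_right_mono) auto
  also have "\<dots> = 3 * a\<^sup>2 / (16 * D\<^sup>2)" using D by (simp add: field_simps power2_eq_square)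
  also have "\<dots> \<le> 3 * a / (16 * D)" using D2 a2 a D by (intro frac_le) auto
  also have "\<dots> \<le> a / (2 * D) / 2" using a D by (simp add: field_simps)
  finally show "(2 * real d + (real d)\<^sup>2) * (decay_rate d a)\<^sup>2 \<le> a / (2 * real d) / 2" unfolding r D_def[symmetric] .
qed

lemma l2_const_nonneg: "\<lbrakk>1 \<le> d; 0 < a\<rbrakk> \<Longrightarrow> 0 \<le> l2_const d a"
  by (simp add: l2_const_def decay_rate_def)

lemma sup_const_pos: "\<lbrakk>1 \<le> d; 0 < a\<rbrakk> \<Longrightarrow> 0 < sup_const d a"
  unfolding sup_const_def using l2_const_nonneg[of d a]
  by (intro add_pos_nonneg mult_pos_pos mult_nonneg_nonneg) auto

text \<open>The weighted L2 bound is used twice: pointwise on block averages, hence on the source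
  \<open>f - b * avg g\<close> of the massive equation, and for the remainder of the kernel
  expansion.\<close>

lemma real_pointwise_bound:
  assumes d: "1 \<le> d" and a: "0 < a" "a \<le> 1" and b: "a / 2 \<le> b" "b \<le> 1" and m: "0 \<le> m"
    and N: "0 < N" "N dvd M" and x0: "x0 \<in> cube d M"
    and eq: "\<And>x. x \<in> cube d M \<Longrightarrow> block_op d N M m b g x = f x"
    and F: "\<And>x. x \<in> cube d M \<Longrightarrow> \<bar>f x\<bar> \<le> F"
    and D: "0 \<le> D" "\<And>x. x \<in> cube d M \<Longrightarrow> f x \<noteq> 0 \<Longrightarrow> D \<le> rdist d N x0 x"
  shows "\<bar>g x0\<bar> \<le> sup_const d a * (exp (- (decay_rate d a / 2) * D) * F)"
proof -
  define \<delta> where "\<delta> = decay_rate d a"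
  define \<kappa> where "\<kappa> = a / (2 * real d)"
  define B where "B = l2_const d a"
  define e where "e = exp (- (\<delta> / 2) * D) * F"
  let ?r = "rdist d N x0" and ?C = "cube d M"
  define V where "V = (\<Sum>x\<in>?C. (exp (- \<delta> * ?r x) * g x)\<^sup>2)"
  \<comment> \<open>The rate is doubled because \<open>W\<close> has to dominate the inverse square
    of the weight \<open>exp (- \<delta> * ?r x)\<close> up to the factor
    \<open>2 ^ d\<close>.\<close>
  define W where "W = cosh_weight d (2 * \<delta> / N) x0"
  note \<delta> = decay_rate_bounds[OF d a, folded \<delta>_def]
  have F0: "0 \<le> F" using F[OF x0] by linarith
  have e0: "0 \<le> e" using F0 by (simp add: e_def)
  have B0: "0 \<le> B" using l2_const_nonneg[OF d a(1)] by (simp add: B_def)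
  have V0: "0 \<le> V" by (simp add: V_def sum_nonneg)
  have \<kappa>: "\<kappa> \<le> b" "0 < \<kappa>" "\<kappa> * d \<le> 2"
  proof -
    have "a / (2 * real d) \<le> a / 2" using a d by (intro divide_left_mono) auto
    then show "\<kappa> \<le> b" using b by (simp add: \<kappa>_def)
    show "0 < \<kappa>" "\<kappa> * d \<le> 2" using a d by (simp_all add: \<kappa>_def)
  qed
  have "V \<le> (2 / \<kappa>)\<^sup>2 * (\<Sum>x\<in>?C. (exp (- \<delta> * ?r x) * f x)\<^sup>2)"
    unfolding V_def
  proof (rule weighted_l2_bound[OF N m b(2) \<kappa>, where \<delta> = \<delta>])
    show "\<bar>fdiff \<nu> (\<lambda>x. - \<delta> * ?r x) x\<bar> \<le> \<delta> / N" if "\<nu> < d" for \<nu> x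
    proof -
      have "fdiff \<nu> (\<lambda>x. - \<delta> * ?r x) x = - \<delta> * fdiff \<nu> ?r x"
        by (simp add: fdiff_def right_diff_distrib)
      then show ?thesis
        using \<delta>(1) mult_left_mono[OF fdiff_rdist_le[OF that, of N x0 x], of \<delta>] by (simp add: abs_mult)
    qed
    show "\<bar>- \<delta> * ?r x - - \<delta> * ?r y\<bar> \<le> \<delta> * d" if "y \<in> cell d N M x" for x y
    proof -
      have "- \<delta> * ?r x - - \<delta> * ?r y = - \<delta> * (?r x - ?r y)" by (simp add: algebra_simps)
      then show ?thesis
        using \<delta>(1) mult_left_mono[OF rdist_cell_le[OF N(1) that, of x0], of \<delta>] by (simp add: abs_mult)
    qed
  qed (use \<delta> eq in \<open>auto simp: \<kappa>_def\<close>)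
  \<comment> \<open>One factor \<open>exp (- \<delta> * ?r x)\<close> of the squared weight is
    traded for \<open>exp (- \<delta> * D)\<close>, the square of the decay in \<open>e\<close>; the
    other stays for summation.\<close>
  also have "\<dots> \<le> (2 / \<kappa>)\<^sup>2 * (\<Sum>x\<in>?C. e\<^sup>2 * exp (- \<delta> * ?r x))"
  proof (intro mult_left_mono sum_mono)
    fix x assume x: "x \<in> ?C"
    show "(exp (- \<delta> * ?r x) * f x)\<^sup>2 \<le> e\<^sup>2 * exp (- \<delta> * ?r x)"
    proof (cases "f x = 0")
      case True then show ?thesis by simp
    next
      case False
      have "(f x)\<^sup>2 \<le> F\<^sup>2" using F[OF x] F0 by (simp add: abs_le_square_iff[symmetric])
      moreover have "exp (- \<delta> * ?r x) \<le> exp (- \<delta> * D)" using D(2)[OF x False] \<delta>(1) by simp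
      ultimately have "exp (- \<delta> * ?r x) * (f x)\<^sup>2 \<le> exp (- \<delta> * D) * F\<^sup>2" by (intro mult_mono) auto
      also have "\<dots> = e\<^sup>2"
        by (simp add: e_def power_mult_distrib flip: exp_double)
      finally have "exp (- \<delta> * ?r x) * (exp (- \<delta> * ?r x) * (f x)\<^sup>2) \<le> exp (- \<delta> * ?r x) * e\<^sup>2"
        by (intro mult_left_mono) auto
      then show ?thesis by (simp add: power_mult_distrib power2_eq_square mult_ac)
    qed
  qed simp
  also have "\<dots> = (2 / \<kappa>)\<^sup>2 * e\<^sup>2 * (\<Sum>x\<in>?C. exp (- \<delta> * ?r x))" by (simp add: sum_distrib_left mult.assoc)
  also have "\<dots> \<le> (2 / \<kappa>)\<^sup>2 * e\<^sup>2 * (real N ^ d * (2 * (1 + 1 / \<delta>)) ^ d)"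
    using sum_exp_rdist_le[OF \<delta>(1) N(1) x0] by (intro mult_left_mono) auto
  also have "\<dots> = real N ^ d * (B * e)\<^sup>2"
    using a d \<delta>(1) by (simp add: B_def l2_const_def \<delta>_def \<kappa>_def power_mult_distrib power_divide)
  finally have VB: "V \<le> real N ^ d * (B * e)\<^sup>2" .

  have W_ge: "exp (2 * \<delta> * ?r x) \<le> 2 ^ d * W x" for x
    unfolding W_def using \<delta>(1) by (intro cosh_weight_ge N) auto
  have W_pos: "0 < W x" for x unfolding W_def by (rule cosh_weight_pos)
  have exp_le: "exp (\<delta> * ?r x) \<le> 2 ^ d * W x" for x
  proof -
    have "exp (\<delta> * ?r x) \<le> exp (2 * \<delta> * ?r x)"
      using \<delta>(1) rdist_nonneg[of d N x0 x] by simp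
    then show ?thesis using W_ge[of x] by linarith
  qed
  \<comment> \<open>On the support the distance is at least \<open>D\<close>, so the growth of
    \<open>W\<close> makes up for the decay factor inside \<open>e\<close>.\<close>
  have f_le: "\<bar>f x\<bar> \<le> e * (2 ^ d * W x)" if x: "x \<in> ?C" for x
  proof (cases "f x = 0")
    case True then show ?thesis using e0 W_pos[of x] by simp
  next
    case False
    have "\<delta> / 2 * D \<le> \<delta> * D" using \<delta>(1) D(1) by (intro mult_right_mono) auto
    also have "\<dots> \<le> \<delta> * ?r x" using \<delta>(1) D(2)[OF x False] by simp
    finally have "1 \<le> exp (- (\<delta> / 2) * D) * exp (\<delta> * ?r x)" by (simp flip: exp_add)
    then have "1 * F \<le> exp (- (\<delta> / 2) * D) * exp (\<delta> * ?r x) * F" using F0 by (rule mult_right_mono)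
    then have "\<bar>f x\<bar> \<le> e * exp (\<delta> * ?r x)" using F[OF x] by (simp add: e_def mult_ac)
    also have "\<dots> \<le> e * (2 ^ d * W x)" using e0 exp_le by (rule mult_left_mono[rotated])
    finally show ?thesis .
  qed
  \<comment> \<open>A mean over \<open>N ^ d\<close> sites turns the L2 bound into a pointwise one
    with no loss in \<open>N\<close>; the weight varies by at most \<open>exp 1\<close> within a
    cell.\<close>
  have avg_le: "\<bar>avg d N M g x\<bar> \<le> exp 1 * B * e * (2 ^ d * W x)" if x: "x \<in> ?C" for x
  proof -
    have "(g y)\<^sup>2 \<le> (exp 1 * exp (\<delta> * ?r x))\<^sup>2 * (exp (- \<delta> * ?r y) * g y)\<^sup>2" if y: "y \<in> cell d N M x" for y
    proof -
      have "\<delta> * ?r y \<le> \<delta> * (?r x + d)"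
        using rdist_cell_le[OF N(1) y, of x0] \<delta>(1) by (intro mult_left_mono) auto
      also have "\<dots> \<le> 1 + \<delta> * ?r x" using \<delta>(3) by (simp add: distrib_left)
      finally have "1 \<le> exp 1 * exp (\<delta> * ?r x) * exp (- \<delta> * ?r y)" by (simp flip: exp_add)
      then have "1 * (g y)\<^sup>2 \<le> (exp 1 * exp (\<delta> * ?r x) * exp (- \<delta> * ?r y))\<^sup>2 * (g y)\<^sup>2"
        by (intro mult_right_mono one_le_power) auto
      then show ?thesis by (simp add: power_mult_distrib mult_ac)
    qed
    then have "(\<Sum>y\<in>cell d N M x. (g y)\<^sup>2)
        \<le> (exp 1 * exp (\<delta> * ?r x))\<^sup>2 * (\<Sum>y\<in>cell d N M x. (exp (- \<delta> * ?r y) * g y)\<^sup>2)"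
      unfolding sum_distrib_left by (rule sum_mono)
    also have "\<dots> \<le> (exp 1 * exp (\<delta> * ?r x))\<^sup>2 * V"
      unfolding V_def by (intro mult_left_mono sum_mono2) (auto simp: cell_def)
    also have "\<dots> \<le> (exp 1 * exp (\<delta> * ?r x))\<^sup>2 * (real N ^ d * (B * e)\<^sup>2)"
      using VB by (intro mult_left_mono) auto
    finally have "(\<Sum>y\<in>cell d N M x. (g y)\<^sup>2) / real N ^ d \<le> (exp 1 * exp (\<delta> * ?r x) * (B * e))\<^sup>2"
      using N by (simp add: divide_le_eq power_mult_distrib mult_ac)
    with avg_sq_le[OF N x, of g] have "(avg d N M g x)\<^sup>2 \<le> (exp 1 * exp (\<delta> * ?r x) * (B * e))\<^sup>2" by linarith
    then have "\<bar>avg d N M g x\<bar> \<le> exp 1 * exp (\<delta> * ?r x) * (B * e)"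
      using B0 e0 by (subst (asm) power2_le_iff_abs_le) auto
    also have "\<dots> = exp 1 * B * e * exp (\<delta> * ?r x)" by (simp add: mult_ac)
    also have "\<dots> \<le> exp 1 * B * e * (2 ^ d * W x)" using B0 e0 exp_le by (intro mult_left_mono) auto
    finally show ?thesis .
  qed
  obtain K where K: "resolvent_chain d N M m x0 K" using resolvent_chain_exists[OF m] by blast
  have "\<bar>g x0\<bar> \<le> 2 ^ (2 * d + 1) * (2 ^ d * (1 + exp 1 * B) * e)
      + sqrt (2 ^ (2 * d) * (2 / N) ^ d * (\<Sum>x\<in>?C. (g x)\<^sup>2 / W x))"
  proof (rule chain_pointwise_bound[OF m x0 K N])
    show "W x0 = 1" by (simp add: W_def cosh_weight_self)
    show "W x \<le> 2 * massive_op d N M m W x" if "x \<in> ?C" for x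
      unfolding W_def using cosh_weight_supersolution[OF N(1) m _ _ _ that x0] \<delta> by simp
    show "0 < W x" for x by (rule W_pos)
    show "0 \<le> 2 ^ d * (1 + exp 1 * B) * e" using B0 e0 by simp
    show "\<bar>massive_op d N M m g x - g x\<bar> \<le> 2 ^ d * (1 + exp 1 * B) * e * W x" if x: "x \<in> ?C" for x
    proof -
      have "massive_op d N M m g x - g x = f x - b * avg d N M g x"
        using eq[OF x] by (simp add: block_op_def algebra_simps)
      moreover have "\<bar>b * avg d N M g x\<bar> \<le> 1 * \<bar>avg d N M g x\<bar>"
        unfolding abs_mult using a b by (intro mult_right_mono) auto
      ultimately have "\<bar>massive_op d N M m g x - g x\<bar> \<le> e * (2 ^ d * W x) + exp 1 * B * e * (2 ^ d * W x)"
        using f_le[OF x] avg_le[OF x] by linarith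
      then show ?thesis by (simp add: algebra_simps)
    qed
  qed
  \<comment> \<open>The kernel bound \<open>(2 / N) ^ d\<close> meets the volume factor
    \<open>N ^ d\<close> in the bound for \<open>V\<close>, and \<open>N\<close> disappears.\<close>
  also have "sqrt (2 ^ (2 * d) * (2 / N) ^ d * (\<Sum>x\<in>?C. (g x)\<^sup>2 / W x)) \<le> sqrt (16 ^ d) * (B * e)"
  proof -
    have "(g x)\<^sup>2 / W x \<le> 2 ^ d * (exp (- \<delta> * ?r x) * g x)\<^sup>2" for x
    proof -
      have "1 \<le> 2 ^ d * W x * (exp (- \<delta> * ?r x))\<^sup>2"
        using mult_right_mono[OF W_ge[of x], of "(exp (- \<delta> * ?r x))\<^sup>2"]
        by (simp flip: exp_double exp_add)
      then have "1 * (g x)\<^sup>2 \<le> 2 ^ d * W x * (exp (- \<delta> * ?r x))\<^sup>2 * (g x)\<^sup>2" by (intro mult_right_mono) auto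
      then show ?thesis using W_pos[of x] by (simp add: divide_le_eq power_mult_distrib mult_ac)
    qed
    then have "(\<Sum>x\<in>?C. (g x)\<^sup>2 / W x) \<le> 2 ^ d * V"
      unfolding V_def sum_distrib_left by (rule sum_mono)
    also have "\<dots> \<le> 2 ^ d * (real N ^ d * (B * e)\<^sup>2)" using VB by (intro mult_left_mono) auto
    finally have "2 ^ (2 * d) * (2 / N) ^ d * (\<Sum>x\<in>?C. (g x)\<^sup>2 / W x)
        \<le> 2 ^ (2 * d) * (2 / N) ^ d * (2 ^ d * (real N ^ d * (B * e)\<^sup>2))"
      by (intro mult_left_mono) auto
    also have "\<dots> = (2 ^ (2 * d) * 2 ^ d * 2 ^ d) * (B * e)\<^sup>2"
      using N by (simp add: power_divide)
    also have "(2 ^ (2 * d) * 2 ^ d * 2 ^ d :: real) = 16 ^ d"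
      by (simp add: power_mult flip: power_mult_distrib)
    finally have "sqrt (2 ^ (2 * d) * (2 / N) ^ d * (\<Sum>x\<in>?C. (g x)\<^sup>2 / W x)) \<le> sqrt (16 ^ d * (B * e)\<^sup>2)"
      by (rule real_sqrt_le_mono)
    then show ?thesis using B0 e0 by (simp add: real_sqrt_mult)
  qed
  finally show ?thesis
    by (simp add: sup_const_def B_def e_def \<delta>_def algebra_simps)
qed

section \<open>Complex functions\<close>

text \<open>Makes the estimates uniform in \<open>L\<close> and \<open>k\<close>: \<open>L\<close>
  is at least 2, so the numerator loses at most half of \<open>a\<close>, while the quotient of the
  two brackets never exceeds 1.\<close>

lemma a_seq_bounds:
  assumes a: "0 < a" "a \<le> 1" and L: "1 < L" and k: "1 \<le> k"
  shows "a / 2 \<le> a_seq a L k" "a_seq a L k \<le> 1"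
proof -
  define p where "p = real L powr (-2)"
  define q where "q = real L powr (- 2 * real k)"
  have q: "0 < q" "q \<le> p"
    using L k by (auto simp: p_def q_def intro!: powr_mono)
  have "2 powr (2::real) \<le> real L powr 2" using L by (intro powr_mono2) auto
  then have "4 \<le> real L powr 2" by simp
  then have p: "p \<le> 1 / 2" by (simp add: p_def powr_minus_divide divide_le_eq)
  have "a_seq a L k = a * (1 - p) / (1 - q)" by (simp add: a_seq_def p_def q_def)
  moreover have "a * (1 - p) \<le> a * (1 - q)" using a q by (intro mult_left_mono) auto
  then have "a * (1 - p) / (1 - q) \<le> a" using p q by (simp add: pos_divide_le_eq)
  moreover have "a / 2 \<le> a * (1 - p) / (1 - q)"
  proof -
    have "a * (1 / 2) \<le> a * (1 - p)" using a p by (intro mult_left_mono) auto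
    then have 1: "a / 2 \<le> a * (1 - p)" by simp
    have "a * (1 - p) * (1 - q) \<le> a * (1 - p) * 1"
      using a p q by (intro mult_left_mono) auto
    then have "a * (1 - p) \<le> a * (1 - p) / (1 - q)" using p q by (subst pos_le_divide_eq) auto
    with 1 show ?thesis by (rule order_trans)
  qed
  ultimately show "a / 2 \<le> a_seq a L k" "a_seq a L k \<le> 1" using a by auto
qed

text \<open>Real coefficients let real and imaginary parts decouple. Replacing an outside value by
  \<open>g x\<close> makes its difference vanish, which is the omitted term in
  \<open>nlap\<close>.\<close>

lemma Laplacian_eq:
  "Laplacian d L k m g x = - complex_of_real ((real (L ^ k))\<^sup>2) *
     (\<Sum>\<mu><d. Complex (nlap (L ^ m) \<mu> (\<lambda>y. Re (g y)) x) (nlap (L ^ m) \<mu> (\<lambda>y. Im (g y)) x))"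
proof -
  have "nbr_plus L m g x \<mu> - 2 * g x + nbr_minus g x \<mu>
      = - Complex (nlap (L ^ m) \<mu> (\<lambda>y. Re (g y)) x) (nlap (L ^ m) \<mu> (\<lambda>y. Im (g y)) x)" for \<mu>
    by (simp add: nbr_plus_def nbr_minus_def nlap_def complex_eq_iff)
  moreover have "inverse (eta L k ^ 2) = (real (L ^ k))\<^sup>2"
    by (simp add: eta_def power_divide)
  then have "inverse (complex_of_real (eta L k ^ 2)) = complex_of_real ((real (L ^ k))\<^sup>2)"
    by (simp only: of_real_inverse[symmetric])
  ultimately show ?thesis unfolding Laplacian_def by (simp only: sum_negf mult_minus_right mult_minus_left)
qed

lemma Qadj_Qop_eq:
  "Qadj d L k (Qop d L m k g) x
    = Complex (avg d (L ^ k) (L ^ m) (\<lambda>y. Re (g y)) x) (avg d (L ^ k) (L ^ m) (\<lambda>y. Im (g y)) x)"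
proof -
  have "{z \<in> Omega d L m. \<forall>\<mu><d. z \<mu> div L ^ k = (if \<mu> < d then x \<mu> div L ^ k else 0)} = cell d (L ^ k) (L ^ m) x"
    by (auto simp: cell_def Omega_eq_cube)
  moreover have "real L ^ (k * d) = real (L ^ k) ^ d" by (simp add: power_mult)
  ultimately have "Qadj d L k (Qop d L m k g) x
      = (\<Sum>y\<in>cell d (L ^ k) (L ^ m) x. g y) / complex_of_real (real (L ^ k) ^ d)"
    by (simp only: Qadj_def Qop_def divide_inverse mult.commute)
  then show ?thesis by (simp add: avg_def complex_eq_iff)
qed

lemma Aop_eq:
  "Aop d L k m a mu0 g x = Complex
     (block_op d (L ^ k) (L ^ m) (mu_seq mu0 L k) (a_seq a L k) (\<lambda>y. Re (g y)) x)
     (block_op d (L ^ k) (L ^ m) (mu_seq mu0 L k) (a_seq a L k) (\<lambda>y. Im (g y)) x)"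
  unfolding Aop_def Laplacian_eq Qadj_Qop_eq block_op_def
  by (simp add: complex_eq_iff del: of_nat_power of_real_power)

text \<open>The Euclidean norm is at most the l1 norm, so a Euclidean lower bound on the distance to
  the support passes to \<open>rdist\<close>.\<close>

lemma pdist_le_rdist: "pdist d L k x y \<le> rdist d (L ^ k) x y"
proof -
  have "sqrt (\<Sum>\<mu><d. (real (x \<mu>) - real (y \<mu>))\<^sup>2) \<le> (\<Sum>\<mu><d. \<bar>real (x \<mu>) - real (y \<mu>)\<bar>)"
    using L2_set_le_sum_abs[of "\<lambda>\<mu>. real (x \<mu>) - real (y \<mu>)" "{..<d}"] by (simp add: L2_set_def)
  then have "eta L k * sqrt (\<Sum>\<mu><d. (real (x \<mu>) - real (y \<mu>))\<^sup>2) \<le> eta L k * (\<Sum>\<mu><d. \<bar>real (x \<mu>) - real (y \<mu>)\<bar>)"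
    by (intro mult_left_mono) (auto simp: eta_def)
  then show ?thesis
    by (simp add: pdist_def rdist_def eta_def sum_divide_distrib abs_minus_commute)
qed

lemma Gk_bound:
  assumes d: "1 \<le> d" and a: "0 < a" "a \<le> 1" and L: "1 < L" and k: "1 \<le> k" "k \<le> m" and mu0: "0 \<le> mu0"
    and supp: "supp_on (Omega d L m) f \<noteq> {}" and x: "x \<in> Omega d L m"
  shows "cmod (Gk d L k m a mu0 f x) \<le> 2 * sup_const d a *
    (exp (- (decay_rate d a / 2) * dist_set d L k x (supp_on (Omega d L m) f)) * supnorm (Omega d L m) f)"
proof -
  define N where "N = L ^ k"
  define M where "M = L ^ m"
  define b where "b = a_seq a L k"
  define mu where "mu = mu_seq mu0 L k"
  define D where "D = dist_set d L k x (supp_on (Omega d L m) f)"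
  define F where "F = supnorm (Omega d L m) f"
  have \<Omega>: "Omega d L m = cube d M" by (simp add: Omega_eq_cube M_def)
  have N: "0 < N" "N dvd M" using L k by (auto simp: N_def M_def le_imp_power_dvd)
  have b: "a / 2 \<le> b" "b \<le> 1" using a_seq_bounds[OF a L k(1)] by (auto simp: b_def)
  have mu: "0 \<le> mu" using mu0 by (simp add: mu_def mu_seq_def)
  have b0: "0 < b" using a b by linarith
  note A = Aop_eq[of d L k m a mu0, folded N_def M_def b_def mu_def]
  obtain u where u: "\<And>y. y \<notin> cube d M \<Longrightarrow> u y = 0"
      "\<And>y. y \<in> cube d M \<Longrightarrow> block_op d N M mu b u y = Re (f y)"
    using block_op_solvable[OF N mu b0 b(2), of d "\<lambda>y. Re (f y)"] by blast
  obtain v where v: "\<And>y. y \<notin> cube d M \<Longrightarrow> v y = 0"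
      "\<And>y. y \<in> cube d M \<Longrightarrow> block_op d N M mu b v y = Im (f y)"
    using block_op_solvable[OF N mu b0 b(2), of d "\<lambda>y. Im (f y)"] by blast
  have uniq: "p y = q y" if eq: "\<And>y. y \<in> cube d M \<Longrightarrow> block_op d N M mu b p y = block_op d N M mu b q y"
    and "y \<in> cube d M" for p q y
  proof -
    have "block_op d N M mu b (\<lambda>y. (-1) * q y + p y) z = 0" if "z \<in> cube d M" for z
      unfolding block_op_lincomb using eq[OF that] by simp
    from block_op_injective[OF N mu b0 b(2) this that(2)] show ?thesis by simp
  qed
  \<comment> \<open>Existence is solved for both parts separately; injectivity on the cube and the
    vanishing off it give the uniqueness that the definite description asks for.\<close>
  have G: "Gk d L k m a mu0 f = (\<lambda>y. Complex (u y) (v y))"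
    unfolding Gk_def \<Omega>
  proof (rule the_equality)
    show "(\<forall>y. y \<notin> cube d M \<longrightarrow> Complex (u y) (v y) = 0)
        \<and> (\<forall>y\<in>cube d M. Aop d L k m a mu0 (\<lambda>y. Complex (u y) (v y)) y = f y)"
      using u v by (simp add: A complex_eq_iff)
  next
    fix g assume g: "(\<forall>y. y \<notin> cube d M \<longrightarrow> g y = 0) \<and> (\<forall>y\<in>cube d M. Aop d L k m a mu0 g y = f y)"
    then have "block_op d N M mu b (\<lambda>y. Re (g y)) y = Re (f y)"
      "block_op d N M mu b (\<lambda>y. Im (g y)) y = Im (f y)" if "y \<in> cube d M" for y
      using that by (auto simp: A complex_eq_iff)
    then have "Re (g y) = u y \<and> Im (g y) = v y" if "y \<in> cube d M" for y
      using that uniq[of "\<lambda>y. Re (g y)" u] uniq[of "\<lambda>y. Im (g y)" v] u v by simp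
    then have "g y = Complex (u y) (v y)" for y
      using g u(1)[of y] v(1)[of y] by (cases "y \<in> cube d M") (simp_all add: complex_eq_iff)
    then show "g = (\<lambda>y. Complex (u y) (v y))" ..
  qed
  have fin: "finite (supp_on (cube d M) f)" by (simp add: supp_on_def)
  have F: "cmod (f y) \<le> F" if "y \<in> cube d M" for y
    unfolding F_def supnorm_def \<Omega> using that by (intro Max_ge) auto
  have D_le: "D \<le> rdist d N x y" if "y \<in> cube d M" "f y \<noteq> 0" for y
  proof -
    have "D \<le> pdist d L k x y"
      unfolding D_def dist_set_def \<Omega> using that fin by (intro Min_le) (auto simp: supp_on_def)
    then show ?thesis using pdist_le_rdist[of d L k x y] by (simp add: N_def)
  qed
  have D0: "0 \<le> D"
    unfolding D_def dist_set_def
  proof (rule Min.boundedI)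
    show "finite (pdist d L k x ` supp_on (Omega d L m) f)" using fin by (simp add: \<Omega>)
    show "pdist d L k x ` supp_on (Omega d L m) f \<noteq> {}" using supp by simp
    show "0 \<le> t" if "t \<in> pdist d L k x ` supp_on (Omega d L m) f" for t
      using that by (auto simp: pdist_def eta_def intro!: divide_nonneg_nonneg sum_nonneg)
  qed
  have "\<bar>u x\<bar> \<le> sup_const d a * (exp (- (decay_rate d a / 2) * D) * F)"
  proof (rule real_pointwise_bound[OF d a b mu N _ _ _ D0, where g = u and ?x0.0 = x and f = "\<lambda>y. Re (f y)"])
    show "x \<in> cube d M" using x by (simp add: \<Omega>)
    show "block_op d N M mu b u y = Re (f y)" if "y \<in> cube d M" for y using u(2)[OF that] .
    show "\<bar>Re (f y)\<bar> \<le> F" if "y \<in> cube d M" for y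
      using order_trans[OF abs_Re_le_cmod F[OF that]] .
    show "D \<le> rdist d N x y" if "y \<in> cube d M" "Re (f y) \<noteq> 0" for y
      using that by (intro D_le) auto
  qed
  moreover have "\<bar>v x\<bar> \<le> sup_const d a * (exp (- (decay_rate d a / 2) * D) * F)"
  proof (rule real_pointwise_bound[OF d a b mu N _ _ _ D0, where g = v and ?x0.0 = x and f = "\<lambda>y. Im (f y)"])
    show "x \<in> cube d M" using x by (simp add: \<Omega>)
    show "block_op d N M mu b v y = Im (f y)" if "y \<in> cube d M" for y using v(2)[OF that] .
    show "\<bar>Im (f y)\<bar> \<le> F" if "y \<in> cube d M" for y
      using order_trans[OF abs_Im_le_cmod F[OF that]] .
    show "D \<le> rdist d N x y" if "y \<in> cube d M" "Im (f y) \<noteq> 0" for y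
      using that by (intro D_le) auto
  qed
  \<comment> \<open>The factor 2 in the constant comes from adding the two parts.\<close>
  moreover have "cmod (Complex (u x) (v x)) \<le> \<bar>u x\<bar> + \<bar>v x\<bar>"
    using cmod_le[of "Complex (u x) (v x)"] by simp
  ultimately show ?thesis unfolding G D_def[symmetric] F_def[symmetric] by linarith
qed

theorem theoremA:
  fixes d :: nat and a :: real
  assumes "1 \<le> d" and "0 < a" and "a \<le> 1"
  shows "\<exists>c c1 :: real. 0 < c \<and> 0 < c1 \<and>
    (\<forall>(L::nat) (k::nat) (m::nat) (mu0::real) (f :: (nat \<Rightarrow> nat) \<Rightarrow> complex) x.
       odd L \<longrightarrow> 1 < L \<longrightarrow> 1 \<le> k \<longrightarrow> k \<le> m \<longrightarrow> 0 \<le> mu0 \<longrightarrow>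
       supp_on (Omega d L m) f \<noteq> {} \<longrightarrow> x \<in> Omega d L m \<longrightarrow>
       cmod (Gk d L k m a mu0 f x) \<le>
         c * real L ^ (2 * d) * exp (- c1 * dist_set d L k x (supp_on (Omega d L m) f))
           * supnorm (Omega d L m) f)"
proof (rule exI[of _ "2 * sup_const d a"], rule exI[of _ "decay_rate d a / 2"], intro conjI allI impI)
  show "0 < 2 * sup_const d a" using sup_const_pos assms by simp
  show "0 < decay_rate d a / 2" using decay_rate_bounds(1) assms by simp
next
  fix L k m :: nat and mu0 :: real and f :: "(nat \<Rightarrow> nat) \<Rightarrow> complex" and x
  assume h: "1 < L" "1 \<le> k" "k \<le> m" "0 \<le> mu0" "supp_on (Omega d L m) f \<noteq> {}" "x \<in> Omega d L m"
  let ?e = "exp (- (decay_rate d a / 2) * dist_set d L k x (supp_on (Omega d L m) f))"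
  let ?F = "supnorm (Omega d L m) f"
  have "cmod (f x) \<le> ?F"
    unfolding supnorm_def Omega_eq_cube using h by (intro Max_ge) (auto simp: Omega_eq_cube)
  then have F: "0 \<le> ?F" using norm_ge_zero order_trans by blast
  have "cmod (Gk d L k m a mu0 f x) \<le> 1 * (2 * sup_const d a * (?e * ?F))"
    using Gk_bound[OF assms h] by simp
  \<comment> \<open>The constant above is already uniform in \<open>L\<close>; a power of
    \<open>L\<close> is at least 1.\<close>
  also have "\<dots> \<le> real L ^ (2 * d) * (2 * sup_const d a * (?e * ?F))"
    using h F sup_const_pos[OF assms(1,2)]
    by (intro mult_right_mono one_le_power mult_nonneg_nonneg) auto
  finally show "cmod (Gk d L k m a mu0 f x) \<le> 2 * sup_const d a * real L ^ (2 * d) * ?e * ?F"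
    by (simp add: mult_ac)
qed

end
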